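(* Let $(S_n)_{n\ge 0}$ be a one-dimensional simple symmetric random walk with $S_0=0$, and let $$f(4):=\#\{n\ge 1: S_n\in\mathcal{K}_D(n),\ S_n=S_{n-1}-1,\ \#\mathcal{K}_D(n)=4\}.$$ Then $\mathbb{E}(f(4))<+\infty$.
   Context: For $x\in\mathbb{Z}$ and $n\ge 1$, the number of downcrossings of the site $x$ by time $n$ is $\xi_D(x,n):=\#\{0<k\le n: S_k=x,\ S_{k-1}=x+1\}$. A site $x\in\mathbb{Z}$ is a favorite downcrossing site at time $n$ if $\xi_D(x,n)=\max_{y\in\mathbb{Z}}\xi_D(y,n)$; $\mathcal{K}_D(n)$ denotes the set of all such sites. $\#D$ denotes the cardinality of a set $D$. *)

theory Defs
  imports "HOL-Probability.Probability"
begin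

locale simple_symmetric_random_walk = prob_space M
  for M :: "'a measure" and S :: "nat \<Rightarrow> 'a \<Rightarrow> int" +
  assumes start: "\<And>\<omega>. \<omega> \<in> space M \<Longrightarrow> S 0 \<omega> = 0"
    and indep_steps:
      "indep_vars (\<lambda>_. count_space UNIV) (\<lambda>n \<omega>. S (Suc n) \<omega> - S n \<omega>) UNIV"
    and prob_up: "\<And>n. prob {\<omega> \<in> space M. S (Suc n) \<omega> - S n \<omega> = 1} = 1/2"
    and prob_down: "\<And>n. prob {\<omega> \<in> space M. S (Suc n) \<omega> - S n \<omega> = -1} = 1/2"

definition downcrossings :: "(nat \<Rightarrow> int) \<Rightarrow> int \<Rightarrow> nat \<Rightarrow> nat" where
  "downcrossings s x n = card {k. 0 < k \<and> k \<le> n \<and> s k = x \<and> s (k - 1) = x + 1}"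

definition favorite_downcrossing_sites :: "(nat \<Rightarrow> int) \<Rightarrow> nat \<Rightarrow> int set" where
  "favorite_downcrossing_sites s n =
     {x. downcrossings s x n = Max (range (\<lambda>y. downcrossings s y n))}"

text \<open>
  The number of times may be infinite, so it is taken as a counting measure, with values in
  \<open>[0, \<infinity>]\<close>. An infinite set of favorite sites (no downcrossing so far) has \<^const>\<open>card\<close>
  equal to \<open>0\<close>, so it does not interfere for \<open>r > 0\<close>.
\<close>

definition favorite_downcrossing_count :: "nat \<Rightarrow> (nat \<Rightarrow> int) \<Rightarrow> ennreal" where
  "favorite_downcrossing_count r s =
     emeasure (count_space UNIV)
       {n. n \<ge> 1 \<and> s n \<in> favorite_downcrossing_sites s n \<and> s n = s (n - 1) - 1 \<and>
           card (favorite_downcrossing_sites s n) = r}"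

lemma downcrossings_le: "downcrossings s x n \<le> n"
proof -
  have "downcrossings s x n \<le> card {1..n}"
    unfolding downcrossings_def by (intro card_mono) auto
  then show ?thesis by simp
qed

lemma mem_favorite_downcrossing_sites_iff:
  "x \<in> favorite_downcrossing_sites s n \<longleftrightarrow>
     (\<forall>y. downcrossings s y n \<le> downcrossings s x n)"
proof -
  have "finite (range (\<lambda>y. downcrossings s y n))"
    by (rule finite_subset[of _ "{..n}"]) (auto simp: downcrossings_le)
  then show ?thesis
    unfolding favorite_downcrossing_sites_def
    by (auto simp: eq_commute[of _ "Max _"] Max_eq_iff)
qed

context simple_symmetric_random_walk
begin

lemma measurable_walk [measurable]: "S n \<in> measurable M (count_space UNIV)"
proof (induction n)
  case 0
  have "S 0 \<in> measurable M (count_space UNIV) \<longleftrightarrow> (\<lambda>_. 0 :: int) \<in> measurable M (count_space UNIV)"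
    by (intro measurable_cong) (auto simp: start)
  then show ?case by simp
next
  case (Suc n)
  have step: "(\<lambda>\<omega>. S (Suc n) \<omega> - S n \<omega>) \<in> measurable M (count_space UNIV)"
    using indep_steps unfolding indep_vars_def by auto
  have "(\<lambda>\<omega>. S n \<omega> + (S (Suc n) \<omega> - S n \<omega>)) \<in> measurable M (count_space UNIV)"
    using Suc step by measurable
  then show ?case by simp
qed

lemma measurable_downcrossings [measurable]:
  "(\<lambda>\<omega>. downcrossings (\<lambda>k. S k \<omega>) x n) \<in> measurable M (count_space UNIV)"
  unfolding downcrossings_def by measurable

lemma measurable_mem_favorite [measurable]:
  "Measurable.pred M (\<lambda>\<omega>. x \<in> favorite_downcrossing_sites (\<lambda>k. S k \<omega>) n)"
  unfolding mem_favorite_downcrossing_sites_iff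
proof (rule pred_intros_countable)
  fix y
  have [measurable]: "Measurable.pred M (\<lambda>\<omega>. downcrossings (\<lambda>k. S k \<omega>) y n \<le> m)" for m
    by (rule measurable_compose[OF measurable_downcrossings]) simp
  have "Measurable.pred M (\<lambda>\<omega>. \<exists>m. downcrossings (\<lambda>k. S k \<omega>) x n = m \<and>
          downcrossings (\<lambda>k. S k \<omega>) y n \<le> m)"
    by measurable
  then show "Measurable.pred M
      (\<lambda>\<omega>. downcrossings (\<lambda>k. S k \<omega>) y n \<le> downcrossings (\<lambda>k. S k \<omega>) x n)"
    by simp
qed

lemma borel_measurable_favorite_downcrossing_count:
  "(\<lambda>\<omega>. favorite_downcrossing_count r (\<lambda>k. S k \<omega>)) \<in> borel_measurable M"
proof -
  have here [measurable]:
    "Measurable.pred M (\<lambda>\<omega>. S n \<omega> \<in> favorite_downcrossing_sites (\<lambda>k. S k \<omega>) n)" for n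
  proof -
    have "(\<lambda>\<omega>. S n \<omega> \<in> favorite_downcrossing_sites (\<lambda>k. S k \<omega>) n) =
          (\<lambda>\<omega>. \<exists>x. S n \<omega> = x \<and> x \<in> favorite_downcrossing_sites (\<lambda>k. S k \<omega>) n)"
      by auto
    then show ?thesis by simp
  qed
  have card [measurable]:
    "(\<lambda>\<omega>. card (favorite_downcrossing_sites (\<lambda>k. S k \<omega>) n)) \<in> measurable M (count_space UNIV)" for n
  proof -
    have "(\<lambda>\<omega>. card (to_nat ` favorite_downcrossing_sites (\<lambda>k. S k \<omega>) n))
            \<in> measurable M (count_space UNIV)"
      unfolding image_iff[abs_def] Bex_def
      by (intro measurable_card) (simp add: image_iff Bex_def)
    then show ?thesis by (simp add: card_image)
  qed
  have "favorite_downcrossing_count r s =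
      (\<Sum>n. if n \<ge> 1 \<and> s n \<in> favorite_downcrossing_sites s n \<and> s n = s (n - 1) - 1 \<and>
           card (favorite_downcrossing_sites s n) = r then 1 else 0)" for s
    unfolding favorite_downcrossing_count_def
    by (subst nn_integral_indicator[symmetric], simp)
      (simp add: nn_integral_count_space_nat indicator_def of_bool_def)
  then show ?thesis by simp measurable
qed

end

end

theory Submission
  imports Defs "HOL-Real_Asymp.Real_Asymp"
begin

text \<open>
  The summand of \<open>f(4)\<close> at level \<open>k\<close> (the common number of downcrossings of the favorite sites)
  is the weight \<open>\<Sum>\<^sub>w 2\<^bsup>-|w|\<^esup>\<close> of the finite paths \<open>w\<close> whose last step goes down to a site
  \<open>x\<close> that becomes the fourth favorite one. By a combinatorial Ray--Knight theorem, a path is the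
  same as the family of its departures from the single sites, so the downcrossing counts to the
  left and to the right of \<open>x\<close> are independent critical branching processes with geometric
  offspring, with one immigrant per generation between \<open>0\<close> and \<open>x\<close>, and no generation may exceed
  \<open>k\<close>.

  Such a process hits \<open>k\<close> exactly before it exceeds \<open>k\<close> only with probability
  \<open>\<epsilon>\<^sub>k = O(k\<^bsup>-2/5\<^esup>)\<close>, since a generation of size about \<open>k\<close> has fluctuations of order
  \<open>k\<^bsup>1/2\<^esup>\<close>. Hence by the Markov property at the first tie every tie
  costs a factor \<open>\<epsilon>\<^sub>k\<close>, relative to the same weight with no tie. The latter is at most \<open>1\<close>, because
  the first time at which some site reaches the level \<open>k\<close> is unique. This makes the weight of three
  ties \<open>O(\<epsilon>\<^sub>k\<^sup>3)\<close>, which is summable over \<open>k\<close>.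
\<close>

section \<open>Sums of geometric variables\<close>

text \<open>
  \<open>geo_sum a b\<close> is the probability that \<open>a\<close> independent geometric variables of parameter \<open>1/2\<close> sum
  up to \<open>b\<close>; truncated subtraction makes it \<open>\<delta>\<^bsub>b0\<^esub>\<close> for \<open>a = 0\<close>.
\<close>

definition geo_sum :: "nat \<Rightarrow> nat \<Rightarrow> real" where
  "geo_sum a b = real ((a + b - 1) choose b) / 2 ^ (a + b)"

lemma geo_sum_nonneg [simp]: "0 \<le> geo_sum a b"
  by (simp add: geo_sum_def)

lemma geo_sum_0_left: "geo_sum 0 b = (if b = 0 then 1 else 0)"
  by (auto simp: geo_sum_def binomial_eq_0)

lemma geo_sum_Suc_0: "geo_sum (Suc a) 0 = geo_sum a 0 / 2"
  by (simp add: geo_sum_def)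

lemma geo_sum_Suc_Suc:
  "geo_sum (Suc a) (Suc b) = geo_sum a (Suc b) / 2 + geo_sum (Suc a) b / 2"
  by (simp add: geo_sum_def add_divide_distrib)

text \<open>The ratio of neighbouring weights is explicit and close to 1 for \<open>b\<close> near
  \<open>a\<close>; this local flatness drives the hazard estimate.\<close>

lemma geo_sum_Suc_ratio:
  "2 * (real b + 1) * geo_sum a (Suc b) = (real a + real b) * geo_sum a b"
proof (cases "a = 0")
  case False
  then obtain c where c: "a = Suc c" by (cases a) auto
  have "Suc b * ((c + Suc b) choose Suc b) = (c + b + 1) * ((c + b) choose b)"
    using Suc_times_binomial_eq[of "c + b" b] by (simp add: mult.commute)
  then have "(real b + 1) * real ((c + Suc b) choose Suc b) = (real c + real b + 1) * real ((c + b) choose b)"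
    by (metis (no_types, opaque_lifting) of_nat_mult of_nat_add of_nat_1 of_nat_Suc add.commute)
  then have "(real b + 1) * real ((c + Suc b) choose Suc b) / 2 ^ (c + b + 1) =
      (real c + real b + 1) * real ((c + b) choose b) / 2 ^ (c + b + 1)"
    by (simp only:)
  moreover have "2 * (real b + 1) * geo_sum a (Suc b) =
      (real b + 1) * real ((c + Suc b) choose Suc b) / 2 ^ (c + b + 1)"
    by (simp add: geo_sum_def c field_simps del: binomial_Suc_Suc)
  moreover have "(real a + real b) * geo_sum a b =
      (real c + real b + 1) * real ((c + b) choose b) / 2 ^ (c + b + 1)"
    by (simp add: geo_sum_def c add.commute add.left_commute)
  ultimately show ?thesis by simp
qed (simp add: geo_sum_0_left)

lemma geo_sum_conv:
  "geo_sum (Suc a) b = (\<Sum>c\<le>b. geo_sum a c * (1 / 2) ^ Suc (b - c))"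
proof (induction b)
  case (Suc b)
  have "(\<Sum>c\<le>Suc b. geo_sum a c * (1 / 2) ^ Suc (Suc b - c)) =
        (\<Sum>c\<le>b. geo_sum a c * (1 / 2) ^ Suc (b - c)) / 2 + geo_sum a (Suc b) / 2"
    by (simp add: sum_divide_distrib Suc_diff_le)
  then show ?case by (simp add: geo_sum_Suc_Suc Suc.IH)
qed (simp add: geo_sum_Suc_0)

text \<open>One geometric variable has generating function \<open>1 / (2 - s)\<close>; adding
  another one is a Cauchy product.\<close>

lemma geo_sum_pgf:
  assumes "0 \<le> s" "s < 2"
  shows "(\<lambda>b. geo_sum a b * s ^ b) sums (1 / (2 - s)) ^ a"
proof (induction a)
  case 0
  have "(\<lambda>b. geo_sum 0 b * s ^ b) = (\<lambda>b. if b = 0 then 1 else 0)"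
    by (auto simp: geo_sum_0_left)
  then show ?case using sums_single[of 0 "\<lambda>_. 1::real"] by simp
next
  case (Suc a)
  have geo: "(\<lambda>b. (s / 2) ^ b * (1 / 2)) sums (1 / (1 - s / 2) * (1 / 2))"
    using assms by (intro sums_mult2 geometric_sums) auto
  have "(\<lambda>b. \<Sum>i\<le>b. (geo_sum a i * s ^ i) * ((s / 2) ^ (b - i) * (1 / 2)))
        sums ((\<Sum>b. geo_sum a b * s ^ b) * (\<Sum>b. (s / 2) ^ b * (1 / 2)))"
  proof (rule Cauchy_product_sums)
    show "summable (\<lambda>k. norm (geo_sum a k * s ^ k))"
      using Suc assms by (simp add: abs_mult sums_iff)
    show "summable (\<lambda>k. norm ((s / 2) ^ k * (1 / 2)))"
      using geo assms by (simp add: sums_iff)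
  qed
  also have "(\<Sum>b. geo_sum a b * s ^ b) * (\<Sum>b. (s / 2) ^ b * (1 / 2)) = (1 / (2 - s)) ^ Suc a"
  proof -
    have "(\<Sum>b. geo_sum a b * s ^ b) = (1 / (2 - s)) ^ a"
      using Suc by (simp add: sums_iff)
    moreover have "(\<Sum>b. (s / 2) ^ b * (1 / 2)) = 1 / (2 - s)"
      using geo assms by (simp add: sums_iff field_simps)
    ultimately show ?thesis by simp
  qed
  also have "(\<lambda>b. \<Sum>i\<le>b. (geo_sum a i * s ^ i) * ((s / 2) ^ (b - i) * (1 / 2))) =
             (\<lambda>b. geo_sum (Suc a) b * s ^ b)"
  proof
    fix b
    have "(\<Sum>i\<le>b. (geo_sum a i * s ^ i) * ((s / 2) ^ (b - i) * (1 / 2))) =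
          (\<Sum>i\<le>b. geo_sum a i * (1 / 2) ^ Suc (b - i) * s ^ b)"
      by (intro sum.cong refl)
        (simp add: power_divide power_add[symmetric] divide_simps)
    then show "(\<Sum>i\<le>b. (geo_sum a i * s ^ i) * ((s / 2) ^ (b - i) * (1 / 2))) =
          geo_sum (Suc a) b * s ^ b"
      by (simp add: geo_sum_conv sum_distrib_right)
  qed
  finally show ?case .
qed

lemma geo_sum_pgf_le:
  assumes "0 \<le> s" "s < 2" "finite A"
  shows "(\<Sum>b\<in>A. geo_sum a b * s ^ b) \<le> (1 / (2 - s)) ^ a"
  using sum_le_suminf[of "\<lambda>b. geo_sum a b * s ^ b" A] geo_sum_pgf[OF assms(1,2), of a] assms
  by (simp add: sums_iff)

lemma sum_geo_sum_le_1: "finite A \<Longrightarrow> (\<Sum>b\<in>A. geo_sum a b) \<le> 1"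
  using geo_sum_pgf_le[of 1 A a] by simp

text \<open>Stochastic monotonicity in the number of summands. The recursion bounds the left side
  \<open>L\<close> by \<open>R / 2 + L / 2\<close>, with \<open>R\<close> the right side, because
  shifting the argument of \<open>f\<close> only decreases it.\<close>

lemma sum_geo_sum_Suc_le:
  assumes f: "\<And>b. b < n \<Longrightarrow> 0 \<le> f b" and anti: "\<And>b. Suc b < n \<Longrightarrow> f (Suc b) \<le> f b"
  shows "(\<Sum>b<n. geo_sum (Suc a) b * f b) \<le> (\<Sum>b<n. geo_sum a b * f b)"
proof (cases n)
  case (Suc m)
  have "(\<Sum>b<n. geo_sum (Suc a) b * f b) =
        geo_sum a 0 / 2 * f 0 + (\<Sum>b<m. (geo_sum a (Suc b) / 2 + geo_sum (Suc a) b / 2) * f (Suc b))"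
    unfolding Suc sum.lessThan_Suc_shift by (simp add: geo_sum_Suc_0 geo_sum_Suc_Suc)
  also have "\<dots> = (\<Sum>b<n. geo_sum a b * f b) / 2 + (\<Sum>b<m. geo_sum (Suc a) b * f (Suc b)) / 2"
    unfolding Suc sum.lessThan_Suc_shift
    by (simp add: sum_divide_distrib sum.distrib algebra_simps add_divide_distrib)
  finally have "(\<Sum>b<n. geo_sum (Suc a) b * f b) =
      (\<Sum>b<n. geo_sum a b * f b) / 2 + (\<Sum>b<m. geo_sum (Suc a) b * f (Suc b)) / 2" .
  moreover have "(\<Sum>b<m. geo_sum (Suc a) b * f (Suc b)) \<le> (\<Sum>b<m. geo_sum (Suc a) b * f b)"
    using anti Suc by (intro sum_mono mult_left_mono) auto
  moreover have "(\<Sum>b<m. geo_sum (Suc a) b * f b) \<le> (\<Sum>b<n. geo_sum (Suc a) b * f b)"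
    using f Suc by (intro sum_mono2) auto
  ultimately show ?thesis by linarith
qed simp

lemma geo_sum_Suc_ge: "geo_sum a b / 2 \<le> geo_sum (Suc a) b"
  by (cases b) (simp_all add: geo_sum_Suc_0 geo_sum_Suc_Suc)

text \<open>On the window of length \<open>m\<close> starting at \<open>c\<close> the weights lose
  at most half of their initial value, so the weight at \<open>c\<close> is at most twice their
  average there.\<close>

lemma geo_sum_hazard:
  assumes "c \<le> a + u" "0 < m" "real m * (real u + real m + 1) \<le> real c"
  shows "geo_sum a c \<le> 2 / real m * (\<Sum>b = c..<c + m. geo_sum a b)"
proof -
  \<comment> \<open>By \<open>geo_sum_Suc_ratio\<close> the ratio is
    \<open>1 - (b + 2 - a) / (2 * (b + 1))\<close>; in the window \<open>b + 2 - a\<close> is at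
    most \<open>u + m + 1\<close>, which makes \<open>q\<close> a lower bound.\<close>
  define q where "q = 1 - (real u + real m + 1) / (2 * real c)"
  have c0: "real c > 0"
    using assms by (smt (verit, best) mult_pos_pos of_nat_0_less_iff of_nat_0_le_iff)
  have "real u + real m + 1 \<le> real m * (real u + real m + 1)"
    using assms(2) by (cases m) (auto simp: algebra_simps)
  then have "real u + real m + 1 \<le> real c" using assms(3) by linarith
  then have q0: "q \<ge> 0" using c0 by (simp add: q_def field_simps)
  have step: "geo_sum a (Suc (c + i)) \<ge> q * geo_sum a (c + i)" if "i < m" for i
  proof -
    have "q \<le> (real a + real (c + i)) / (2 * (real (c + i) + 1))"
    proof -
      have "(real (c + i) + 2 - real a) / (2 * (real (c + i) + 1)) \<le> (real u + real m + 1) / (2 * real c)"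
        if "real (c + i) + 2 - real a \<ge> 0"
        using that assms(1) \<open>i < m\<close> c0 by (intro frac_le) auto
      moreover have "(real (c + i) + 2 - real a) / (2 * (real (c + i) + 1)) \<le> (real u + real m + 1) / (2 * real c)"
        if "real (c + i) + 2 - real a < 0"
        by (rule order.trans[of _ 0]) (use that c0 in \<open>auto simp: divide_nonpos_pos\<close>)
      ultimately have "(real (c + i) + 2 - real a) / (2 * (real (c + i) + 1)) \<le> (real u + real m + 1) / (2 * real c)"
        by linarith
      moreover have "(real a + real (c + i)) / (2 * (real (c + i) + 1)) =
            1 - (real (c + i) + 2 - real a) / (2 * (real (c + i) + 1))"
        by (simp add: field_simps)
      ultimately show ?thesis by (simp add: q_def)
    qed
    then have "q * geo_sum a (c + i) \<le> (real a + real (c + i)) / (2 * (real (c + i) + 1)) * geo_sum a (c + i)"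
      by (rule mult_right_mono) simp
    also have "\<dots> = geo_sum a (Suc (c + i))"
      using geo_sum_Suc_ratio[of "c + i" a] by (simp add: field_simps)
    finally show ?thesis .
  qed
  have pow: "geo_sum a (c + i) \<ge> q ^ i * geo_sum a c" if "i < m" for i
    using that
  proof (induction i)
    case (Suc i)
    then have "q ^ Suc i * geo_sum a c \<le> q * geo_sum a (c + i)"
      using q0 by (simp add: mult.assoc mult_left_mono)
    also have "\<dots> \<le> geo_sum a (Suc (c + i))" using Suc by (intro step) auto
    finally show ?case by simp
  qed simp
  have q1: "q \<le> 1" using c0 by (simp add: q_def)
  have half: "1 / 2 \<le> q ^ i" if "i < m" for i
  proof -
    \<comment> \<open>The quadratic condition on \<open>m\<close> is exactly what keeps the total
      Bernoulli loss \<open>m * (1 - q)\<close> below 1/2.\<close>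
    have "1 / 2 \<le> 1 - real m * ((real u + real m + 1) / (2 * real c))"
      using assms(3) c0 by (simp add: field_simps)
    also have "\<dots> = 1 + real m * (q - 1)"
      by (simp add: q_def)
    also have "\<dots> \<le> (1 + (q - 1)) ^ m"
      using q0 by (intro Bernoulli_inequality) auto
    also have "\<dots> = q ^ m" by simp
    also have "\<dots> \<le> q ^ i"
      using that q0 q1 by (intro power_decreasing) auto
    finally show ?thesis .
  qed
  have "real m * (geo_sum a c / 2) = (\<Sum>i<m. 1 / 2 * geo_sum a c)" by simp
  also have "\<dots> \<le> (\<Sum>i<m. geo_sum a (c + i))"
    using half pow by (intro sum_mono order.trans[OF mult_right_mono pow]) auto
  also have "\<dots> = (\<Sum>b = c..<c + m. geo_sum a b)"
    by (rule sum.reindex_bij_witness[of _ "\<lambda>b. b - c" "\<lambda>i. c + i"]) auto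
  finally show ?thesis using assms(2) by (simp add: field_simps)
qed

text \<open>Exponential Markov inequality: \<open>a\<close> critical offspring counts reach
  \<open>c\<close> from a distance \<open>u\<close>, measured on the scale \<open>sqrt c\<close> of
  their fluctuations.\<close>

lemma geo_sum_chernoff:
  assumes "2 \<le> c" "a + u \<le> c"
  shows "geo_sum a c \<le> exp (2 - real u / sqrt (real c))"
proof -
  \<comment> \<open>The generating function is taken at \<open>1 + t\<close>. This \<open>t\<close>
    bounds the loss \<open>(1 - t^2)^(-c)\<close> by \<open>exp 2\<close> and leaves the gain
    \<open>(1 - t)^u\<close>.\<close>
  define t where "t = 1 / sqrt (real c)"
  have t: "0 < t" "t < 1" using assms(1) by (auto simp: t_def real_less_rsqrt)
  have t2: "t\<^sup>2 = 1 / real c" using assms(1) by (simp add: t_def power_divide)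
  have "geo_sum a c * (1 + t) ^ c \<le> (1 / (1 - t)) ^ a"
    using geo_sum_pgf_le[of "1 + t" "{c}" a] t by simp
  then have "geo_sum a c \<le> (1 / (1 - t)) ^ a / (1 + t) ^ c"
    using t by (simp add: field_simps)
  also have "\<dots> = (1 - t) ^ (c - a) / ((1 - t) * (1 + t)) ^ c"
  proof -
    have "(1 - t) ^ c = (1 - t) ^ (c - a) * (1 - t) ^ a"
      using assms(2) by (simp add: power_add[symmetric])
    moreover have "(1 - t) ^ a \<noteq> 0" "(1 - t) ^ (c - a) \<noteq> 0" "(1 + t) ^ c \<noteq> 0" using t by auto
    ultimately show ?thesis
      by (simp add: power_mult_distrib power_one_over divide_simps)
  qed
  also have "(1 - t) * (1 + t) = 1 - 1 / real c"
    by (simp add: t2[symmetric] power2_eq_square algebra_simps)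
  also have "(1 - t) ^ (c - a) / (1 - 1 / real c) ^ c \<le> exp (- real u / sqrt (real c)) / exp (- 2)"
  proof (rule frac_le)
    have "(1 - t) ^ (c - a) \<le> (1 - t) ^ u"
      using t assms(2) by (intro power_decreasing) auto
    also have "\<dots> \<le> exp (- t) ^ u"
      using t exp_ge_add_one_self[of "- t"] by (intro power_mono) auto
    also have "\<dots> = exp (- real u / sqrt (real c))"
      by (simp add: exp_of_nat_mult[symmetric] t_def)
    finally show "(1 - t) ^ (c - a) \<le> exp (- real u / sqrt (real c))" .
    have "1 / (1 - 1 / real c) = 1 + 1 / (real c - 1)"
      using assms(1) by (simp add: field_simps)
    also have "\<dots> \<le> exp (1 / (real c - 1))" by (rule exp_ge_add_one_self)
    finally have "1 / exp (1 / (real c - 1)) \<le> 1 - 1 / real c"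
      using assms(1) by (simp add: field_simps)
    then have base: "exp (- 1 / (real c - 1)) \<le> 1 - 1 / real c"
      by (simp add: exp_minus inverse_eq_divide)
    have "exp (- 2) \<le> exp (- real c / (real c - 1))"
      using assms(1) by (simp add: field_simps)
    also have "\<dots> = exp (- 1 / (real c - 1)) ^ c"
      by (simp add: exp_of_nat_mult[symmetric])
    also have "\<dots> \<le> (1 - 1 / real c) ^ c"
      using base by (intro power_mono) auto
    finally show "exp (- 2) \<le> (1 - 1 / real c) ^ c" .
  qed auto
  finally show ?thesis by (simp add: exp_diff exp_minus field_simps)
qed


text \<open>
  A bound for the probability to hit \<open>c\<close> exactly: the first term comes from the hazard rate of
  \<open>geo_sum a\<close> at \<open>c\<close> for \<open>a \<ge> c - u\<close>. From \<open>a \<le> c - u\<close> a jump to \<open>c\<close> is exponentially unlikely,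
  and the second term is its probability times the expected number of generations below \<open>c\<close>.
\<close>

definition hit_bound :: "nat \<Rightarrow> nat \<Rightarrow> nat \<Rightarrow> real" where
  "hit_bound c u m = 2 / real m + 8 * (real c + 1)\<^sup>2 * exp (2 - real u / sqrt (real c))"

text \<open>
  Super-solutions are sought in the form \<open>2 / m + w\<close>, where the decrease of \<open>w\<close> along the process
  pays for the jumps to \<open>c\<close> from far below.
\<close>

lemma hazard_drift:
  assumes m: "0 < m" "real m * (real u + real m + 1) \<le> real c" and c: "2 \<le> c"
    and w: "\<And>b. b < c \<Longrightarrow> 0 \<le> w b"
    and drift: "(\<Sum>b<c. geo_sum a b * w b) \<le> w0"
    and small: "a + u \<le> c \<Longrightarrow> exp (2 - real u / sqrt (real c)) \<le> w0 - (\<Sum>b<c. geo_sum a b * w b)"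
  shows "(\<Sum>b<c. geo_sum a b * (2 / real m + w b)) + geo_sum a c \<le> 2 / real m + w0"
proof (cases "a + u \<le> c")
  case True
  have "(\<Sum>b<c. geo_sum a b * (2 / real m)) \<le> 1 * (2 / real m)"
    unfolding sum_distrib_right[symmetric] by (intro mult_right_mono sum_geo_sum_le_1) auto
  then show ?thesis
    using geo_sum_chernoff[OF c True] small[OF True] by (simp add: distrib_left sum.distrib)
next
  case False
  \<comment> \<open>The hazard bound charges the jump to \<open>c\<close> to the mass on
    \<open>c..<c + m\<close>, which together with the mass below \<open>c\<close> is at most
    1.\<close>
  have "(\<Sum>b<c. geo_sum a b * (2 / real m)) + geo_sum a c \<le>
      2 / real m * ((\<Sum>b<c. geo_sum a b) + (\<Sum>b = c..<c + m. geo_sum a b))"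
    using geo_sum_hazard[of c a u m] m False
    by (simp only: distrib_left sum_distrib_right[symmetric] mult.commute) simp
  also have "(\<Sum>b<c. geo_sum a b) + (\<Sum>b = c..<c + m. geo_sum a b) = (\<Sum>b<c + m. geo_sum a b)"
    by (simp add: lessThan_atLeast0 sum.atLeastLessThan_concat)
  also have "2 / real m * \<dots> \<le> 2 / real m * 1"
    by (intro mult_left_mono sum_geo_sum_le_1) auto
  finally show ?thesis using drift by (simp add: distrib_left sum.distrib)
qed

text \<open>Without immigration \<open>w\<close> is the concave function
  \<open>D * (1 - s ^ a)\<close> of a critical process: the mean of \<open>s ^ b\<close> exceeds
  \<open>s ^ a\<close> by at least the factor \<open>1 + a / n^2\<close>, so \<open>w\<close>
  decreases on average.\<close>

lemma hit_super_solution: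
  assumes m: "0 < m" "real m * (real u + real m + 1) \<le> real c" and c: "2 \<le> c" "0 < u"
  shows "\<exists>h. (\<forall>a. 0 \<le> h a \<and> h a \<le> hit_bound c u m) \<and>
    (\<forall>a. (\<Sum>b<c. geo_sum a b * h b) + geo_sum a c \<le> h a)"
proof -
  \<comment> \<open>With this \<open>n\<close>, \<open>s ^ a\<close> stays above 1/2 for
    \<open>a \<le> c\<close>. The drop is then at least \<open>D / (2 * n^2)\<close> for
    \<open>a > 0\<close>, which fixes \<open>D\<close>.\<close>
  define n where "n = 2 * (real c + 1)"
  define s where "s = 1 - 1 / n"
  define D where "D = 2 * n\<^sup>2 * exp (2 - real u / sqrt (real c))"
  have n: "n \<ge> 6" using c by (simp add: n_def)
  have s: "0 \<le> s" "s < 1" "s \<noteq> 0" using n by (auto simp: s_def)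
  have D0: "D \<ge> 0" by (simp add: D_def)
  define h where "h a = 2 / real m + D * (1 - s ^ a)" for a :: nat
  have bound: "0 \<le> h a" "h a \<le> hit_bound c u m" for a
  proof -
    have "0 \<le> s ^ a" "s ^ a \<le> 1" using s by (auto simp: power_le_one)
    then have "0 \<le> D * (1 - s ^ a)" "D * (1 - s ^ a) \<le> D * 1"
      using D0 by (auto intro!: mult_left_mono simp del: mult_1_right)
    moreover have "D = 8 * (real c + 1)\<^sup>2 * exp (2 - real u / sqrt (real c))"
      by (simp only: D_def n_def power_mult_distrib) simp
    ultimately show "0 \<le> h a" "h a \<le> hit_bound c u m"
      by (auto simp: h_def hit_bound_def)
  qed
  have super: "(\<Sum>b<c. geo_sum a b * h b) + geo_sum a c \<le> h a" for a
  proof -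
    have "(\<lambda>b. geo_sum a b * 1 ^ b - geo_sum a b * s ^ b) sums ((1 / (2 - 1)) ^ a - (1 / (2 - s)) ^ a)"
      using s by (intro sums_diff geo_sum_pgf) auto
    then have "(\<lambda>b. geo_sum a b * (1 - s ^ b)) sums (1 - (1 / (2 - s)) ^ a)"
      by (simp add: right_diff_distrib)
    then have E: "(\<Sum>b<c. geo_sum a b * (1 - s ^ b)) \<le> 1 - (1 / (2 - s)) ^ a"
      using sum_le_suminf[of "\<lambda>b. geo_sum a b * (1 - s ^ b)" "{..<c}"] s
      by (simp add: sums_iff power_le_one)
    have inc: "s ^ a * (1 + real a / n\<^sup>2) \<le> (1 / (2 - s)) ^ a"
    proof -
      have "s * (1 + 1 / n\<^sup>2) \<le> 1 / (2 - s)"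
      proof -
        have "s * (2 - s) = 1 - 1 / n\<^sup>2" using n by (simp add: s_def power2_eq_square field_simps)
        moreover have "s * (1 + 1 / n\<^sup>2) * (2 - s) = (s * (2 - s)) * (1 + 1 / n\<^sup>2)"
          by (simp only: mult_ac)
        ultimately have "s * (1 + 1 / n\<^sup>2) * (2 - s) = (1 - 1 / n\<^sup>2) * (1 + 1 / n\<^sup>2)"
          by simp
        also have "\<dots> \<le> 1" by (simp add: algebra_simps)
        finally show ?thesis using s by (simp add: field_simps)
      qed
      then have "(s * (1 + 1 / n\<^sup>2)) ^ a \<le> (1 / (2 - s)) ^ a"
        using s by (intro power_mono) auto
      moreover have "1 + real a * (1 / n\<^sup>2) \<le> (1 + 1 / n\<^sup>2) ^ a"
        by (intro Bernoulli_inequality) (simp add: order.trans[of _ 0])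
      ultimately show ?thesis
        using s by (simp add: power_mult_distrib) (meson mult_left_mono order.trans zero_le_power)
    qed
    have drift: "(\<Sum>b<c. geo_sum a b * (D * (1 - s ^ b))) \<le> D * (1 - s ^ a) - D * (s ^ a * (real a / n\<^sup>2))"
    proof -
      have "(\<Sum>b<c. geo_sum a b * (D * (1 - s ^ b))) = D * (\<Sum>b<c. geo_sum a b * (1 - s ^ b))"
        by (simp add: sum_distrib_left mult_ac)
      also have "\<dots> \<le> D * (1 - s ^ a * (1 + real a / n\<^sup>2))"
        using E inc D0 by (intro mult_left_mono) auto
      finally show ?thesis by (simp add: algebra_simps)
    qed
    show ?thesis
    \<comment> \<open>The drop vanishes at 0, but there the process is extinct and cannot jump to
      \<open>c\<close>.\<close>
    proof (cases "a = 0")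
      case True
      have "h 0 \<ge> geo_sum 0 c + h 0" using c by (simp add: geo_sum_0_left)
      moreover have "(\<Sum>b<c. geo_sum 0 b * h b) = (\<Sum>b<c. if b = 0 then h b else 0)"
        by (intro sum.cong) (auto simp: geo_sum_0_left)
      ultimately show ?thesis using True c by simp
    next
      case False
      show ?thesis unfolding h_def
      proof (rule hazard_drift[OF m c(1)])
        show "0 \<le> D * (1 - s ^ b)" for b using D0 s by (simp add: power_le_one)
        have "0 \<le> D * (s ^ a * (real a / n\<^sup>2))" using D0 s by simp
        then show "(\<Sum>b<c. geo_sum a b * (D * (1 - s ^ b))) \<le> D * (1 - s ^ a)"
          using drift by linarith
        assume a: "a + u \<le> c"
        have "1 / 2 \<le> 1 + real a * (- (1 / n))"
          using a n by (simp add: n_def field_simps)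
        also have "\<dots> \<le> (1 + - (1 / n)) ^ a"
          using n by (intro Bernoulli_inequality) auto
        finally have "1 / 2 * (1 / n\<^sup>2) \<le> s ^ a * (real a / n\<^sup>2)"
          using False n by (intro mult_mono divide_right_mono) (auto simp: s_def)
        then have "D * (1 / 2 * (1 / n\<^sup>2)) \<le> D * (s ^ a * (real a / n\<^sup>2))"
          using D0 by (rule mult_left_mono)
        then have "exp (2 - real u / sqrt (real c)) \<le> D * (s ^ a * (real a / n\<^sup>2))"
          using n by (simp add: D_def)
        then show "exp (2 - real u / sqrt (real c)) \<le>
            D * (1 - s ^ a) - (\<Sum>b<c. geo_sum a b * (D * (1 - s ^ b)))"
          using drift by linarith
      qed
    qed
  qed
  show ?thesis using bound super by blast
qed

text \<open>The immigrant pushes upwards, so here \<open>w\<close> is the decreasing function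
  \<open>D * s ^ a\<close>. States after immigration do not exceed \<open>c + 1\<close>, and this
  range of \<open>a\<close> keeps \<open>s ^ a\<close> above 1/2.\<close>

lemma hit_super_solution_immigration:
  assumes m: "0 < m" "real m * (real u + real m + 1) \<le> real c" and c: "2 \<le> c"
  shows "\<exists>h. (\<forall>a. 0 \<le> h a \<and> h a \<le> hit_bound c u m) \<and>
    (\<forall>a \<le> Suc c. (\<Sum>b<c. geo_sum a b * h (Suc b)) + geo_sum a c \<le> h a)"
proof -
  define n where "n = 2 * (real c + 1)"
  define s where "s = 1 - 1 / n"
  \<comment> \<open>The drop is at least \<open>D / (4 * n)\<close>, for which a linear prefactor
    would do; the square matches \<open>hit_bound\<close>.\<close>
  define D where "D = 8 * (real c + 1)\<^sup>2 * exp (2 - real u / sqrt (real c))"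
  have n: "n \<ge> 6" using c by (simp add: n_def)
  have s: "0 \<le> s" "s < 1" "s \<noteq> 0" using n by (auto simp: s_def)
  have D0: "D \<ge> 0" by (simp add: D_def)
  define h where "h a = 2 / real m + D * s ^ a" for a :: nat
  have bound: "0 \<le> h a" "h a \<le> hit_bound c u m" for a
  proof -
    have "0 \<le> s ^ a" "s ^ a \<le> 1" using s by (auto simp: power_le_one)
    then have "0 \<le> D * s ^ a" "D * s ^ a \<le> D * 1"
      using D0 by (auto intro!: mult_left_mono simp del: mult_1_right)
    then show "0 \<le> h a" "h a \<le> hit_bound c u m"
      by (auto simp: h_def hit_bound_def D_def)
  qed
  have super: "(\<Sum>b<c. geo_sum a b * h (Suc b)) + geo_sum a c \<le> h a" if a: "a \<le> Suc c" for a
  proof -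
    have E: "(\<Sum>b<c. geo_sum a b * s ^ b) \<le> (1 / (2 - s)) ^ a"
      using s by (intro geo_sum_pgf_le) auto
    have half: "1 / 2 \<le> s ^ a"
    proof -
      have "1 / 2 \<le> 1 + real a * (- (1 / n))"
        using a n by (simp add: n_def field_simps)
      also have "\<dots> \<le> (1 + - (1 / n)) ^ a"
        using n by (intro Bernoulli_inequality) auto
      finally show ?thesis by (simp add: s_def)
    qed
    have dec: "s * (1 / (2 - s)) ^ a \<le> s ^ a * (1 - 1 / (2 * n))"
    proof -
      have q: "s * (2 - s) = 1 - 1 / n\<^sup>2" using n by (simp add: s_def power2_eq_square field_simps)
      have "1 / n\<^sup>2 \<le> 1" using n by (simp add: power2_eq_square field_simps mult_ge1_I)
      then have "1 + real a * (- (1 / n\<^sup>2)) \<le> (1 + - (1 / n\<^sup>2)) ^ a"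
        by (intro Bernoulli_inequality) auto
      moreover have "real a / n\<^sup>2 \<le> 1 / (2 * n)"
        proof -
        have "real a / n\<^sup>2 \<le> (n / 2) / n\<^sup>2" using a by (intro divide_right_mono) (auto simp: n_def)
        then show ?thesis using n by (simp add: power2_eq_square)
      qed
      ultimately have pw: "1 - 1 / (2 * n) \<le> (s * (2 - s)) ^ a" by (simp add: q)
      \<comment> \<open>The immigrant contributes a factor \<open>s\<close>. One of the two factors
        bounding it absorbs the loss through \<open>(s * (2 - s)) ^ a\<close>, the other remains as
        the gain.\<close>
      have "s \<le> (1 - 1 / (2 * n)) * (1 - 1 / (2 * n))"
        using n by (simp add: s_def field_simps)
      also have "\<dots> \<le> (s * (2 - s)) ^ a * (1 - 1 / (2 * n))"
        using pw n by (intro mult_right_mono) auto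
      finally have "s * (1 / (2 - s)) ^ a \<le> (s * (2 - s)) ^ a * (1 - 1 / (2 * n)) * (1 / (2 - s)) ^ a"
        using s by (intro mult_right_mono) auto
      also have "\<dots> = s ^ a * (1 - 1 / (2 * n)) * ((2 - s) * (1 / (2 - s))) ^ a"
        by (simp only: power_mult_distrib mult_ac)
      finally show ?thesis using s by simp
    qed
    have drift: "(\<Sum>b<c. geo_sum a b * (D * s ^ Suc b)) \<le> D * s ^ a - D * (s ^ a * (1 / (2 * n)))"
    proof -
      have "(\<Sum>b<c. geo_sum a b * (D * s ^ Suc b)) = D * (s * (\<Sum>b<c. geo_sum a b * s ^ b))"
        by (simp add: sum_distrib_left mult_ac)
      also have "\<dots> \<le> D * (s * (1 / (2 - s)) ^ a)"
        using E D0 s by (intro mult_left_mono) auto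
      also have "\<dots> \<le> D * (s ^ a * (1 - 1 / (2 * n)))"
        using dec D0 by (rule mult_left_mono)
      finally show ?thesis by (simp add: algebra_simps)
    qed
    show ?thesis unfolding h_def
    proof (rule hazard_drift[OF m c(1)])
      show "0 \<le> D * s ^ Suc b" for b using D0 s by simp
      have "0 \<le> D * (s ^ a * (1 / (2 * n)))" using D0 s n by simp
      then show "(\<Sum>b<c. geo_sum a b * (D * s ^ Suc b)) \<le> D * s ^ a"
        using drift by linarith
      have "1 / 2 * (1 / (2 * n)) \<le> s ^ a * (1 / (2 * n))"
        using half n by (intro mult_right_mono) auto
      then have "D * (1 / 2 * (1 / (2 * n))) \<le> D * (s ^ a * (1 / (2 * n)))"
        using D0 by (rule mult_left_mono)
      moreover have "exp (2 - real u / sqrt (real c)) \<le> D * (1 / 2 * (1 / (2 * n)))"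
        by (simp add: D_def n_def power2_eq_square field_simps)
      ultimately show "exp (2 - real u / sqrt (real c)) \<le>
          D * s ^ a - (\<Sum>b<c. geo_sum a b * (D * s ^ Suc b))"
        using drift by linarith
    qed
  qed
  show ?thesis using bound super by blast
qed

text \<open>The choice is \<open>u\<close> about \<open>c^(3/5)\<close> and \<open>m\<close> about
  \<open>c^(2/5) / 4\<close>: then \<open>m * u\<close> is about \<open>c / 4\<close>, and
  \<open>u / sqrt c\<close> grows like \<open>c^(1/10)\<close>, so the exponential beats the
  polynomial. The main term \<open>2 / m\<close> is about \<open>8 * c^(-2/5)\<close>. Any exponent
  between 1/3 and 1/2 in place of 2/5 would give summability of the cube.\<close>

lemma eventually_hit_bound:
  "\<forall>\<^sub>F c in sequentially. \<exists>u m. 0 < u \<and> 0 < m \<and> real m * (real u + real m + 1) \<le> real c \<and>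
     hit_bound c u m \<le> 9 * real c powr (- 2 / 5)"
proof -
  have "\<forall>\<^sub>F c :: nat in sequentially. real c powr (2 / 5) / 4 > 2"
    by real_asymp
  moreover have "\<forall>\<^sub>F c :: nat in sequentially.
     2 / (real c powr (2 / 5) / 4 - 1) +
     8 * (real c + 1)\<^sup>2 * exp (2 - (real c powr (3 / 5) - 1) / sqrt (real c)) \<le> 9 * real c powr (- 2 / 5)"
    by real_asymp
  moreover have "\<forall>\<^sub>F c :: nat in sequentially. c \<ge> 1"
    by (rule eventually_ge_at_top)
  ultimately show ?thesis
  proof eventually_elim
    case (elim c)
    define u where "u = nat \<lfloor>real c powr (3 / 5)\<rfloor>"
    define m where "m = nat \<lfloor>real c powr (2 / 5) / 4\<rfloor>"
    have floor: "real (nat \<lfloor>t\<rfloor>) \<le> t \<and> t - 1 \<le> real (nat \<lfloor>t\<rfloor>)" if "0 \<le> t" for t :: real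
      using that by linarith
    have u: "real u \<le> real c powr (3 / 5)" "real c powr (3 / 5) - 1 \<le> real u"
      using floor[of "real c powr (3 / 5)"] by (simp_all add: u_def)
    have m: "real m \<le> real c powr (2 / 5) / 4" "real c powr (2 / 5) / 4 - 1 \<le> real m"
      using floor[of "real c powr (2 / 5) / 4"] by (simp_all add: m_def)
    have c1: "real c \<ge> 1" using elim by simp
    have "1 \<le> real c powr (3 / 5)" using c1 by (rule ge_one_powr_ge_zero) simp
    then have u0: "u > 0" by (simp add: u_def)
    have m0: "m > 0" using m(2) elim(1) by linarith
    have "real m * (real u + real m + 1) \<le>
        real c powr (2 / 5) / 4 * (real c powr (3 / 5) + real c powr (3 / 5) + real c powr (3 / 5))"
    proof (intro mult_mono add_mono)
      have "real m \<le> real c powr (2 / 5)" using m(1) by (rule order.trans) simp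
      also have "\<dots> \<le> real c powr (3 / 5)" using c1 by (intro powr_mono) auto
      finally show "real m \<le> real c powr (3 / 5)" .
    qed (use u m \<open>1 \<le> real c powr (3 / 5)\<close> in auto)
    also have "\<dots> = 3 / 4 * (real c powr (2 / 5) * real c powr (3 / 5))" by simp
    also have "real c powr (2 / 5) * real c powr (3 / 5) = real c"
      using c1 by (simp add: powr_add[symmetric])
    finally have cond: "real m * (real u + real m + 1) \<le> real c" using c1 by linarith
    have "2 / real m \<le> 2 / (real c powr (2 / 5) / 4 - 1)"
      using m elim(1) by (intro divide_left_mono mult_pos_pos) auto
    moreover have "exp (2 - real u / sqrt (real c)) \<le> exp (2 - (real c powr (3 / 5) - 1) / sqrt (real c))"
      using u(2) by (simp add: divide_right_mono)
    then have "8 * (real c + 1)\<^sup>2 * exp (2 - real u / sqrt (real c)) \<le>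
        8 * (real c + 1)\<^sup>2 * exp (2 - (real c powr (3 / 5) - 1) / sqrt (real c))"
      by (intro mult_left_mono) auto
    ultimately have "hit_bound c u m \<le> 9 * real c powr (- 2 / 5)"
      using elim(2) unfolding hit_bound_def by linarith
    then show ?case using u0 m0 cond by blast
  qed
qed

section \<open>Ties of branching processes that stay below a level\<close>

text \<open>
  The probability that a branching process with initial value \<open>a\<close>, \<open>d\<close> immigrants and barrier \<open>c\<close>
  in the generation with the entry \<open>(c, d)\<close>, dies out without exceeding a barrier and hits its
  barrier exactly \<open>i\<close> times. Immigrants are added only after the comparison with the barrier.
\<close>

fun tie_prob :: "(nat \<times> nat) list \<Rightarrow> nat \<Rightarrow> nat \<Rightarrow> real" where
  "tie_prob [] a i = (if a = 0 \<and> i = 0 then 1 else 0)"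
| "tie_prob ((c, d) # ps) a i =
     (\<Sum>b<c. geo_sum a b * tie_prob ps (b + d) i) +
     (if i = 0 then 0 else geo_sum a c * tie_prob ps (c + d) (i - 1))"

lemma tie_prob_nonneg [simp]: "0 \<le> tie_prob ps a i"
  by (induction ps arbitrary: a i) (auto intro!: add_nonneg_nonneg sum_nonneg mult_nonneg_nonneg)

text \<open>More individuals make it harder to stay strictly below the barriers and to die out. With
  ties to be collected this monotonicity breaks down, hence the restriction to none.\<close>

lemma tie_prob_0_Suc_le: "tie_prob ps (Suc a) 0 \<le> tie_prob ps a 0"
proof (induction ps arbitrary: a)
  case (Cons p ps)
  obtain c d where p: "p = (c, d)" by (cases p)
  show ?case using Cons by (simp add: p sum_geo_sum_Suc_le)
qed simp

lemma tie_prob_0_antimono: "a \<le> a' \<Longrightarrow> tie_prob ps a' 0 \<le> tie_prob ps a 0"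
  by (rule lift_Suc_antimono_le[of "\<lambda>a. tie_prob ps a 0"]) (auto simp: tie_prob_0_Suc_le)

text \<open>The additional individual has no offspring with probability 1/2. At least one generation
  is needed for it to disappear.\<close>

lemma tie_prob_Suc_ge:
  assumes "ps \<noteq> []" shows "tie_prob ps a i \<le> 2 * tie_prob ps (Suc a) i"
proof -
  obtain c d qs where ps: "ps = (c, d) # qs" using assms by (cases ps) auto
  have step: "geo_sum a b * x \<le> 2 * (geo_sum (Suc a) b * x)" if "0 \<le> x" for b x
    using mult_right_mono[OF geo_sum_Suc_ge that, of a b] by simp
  have "(\<Sum>b<c. geo_sum a b * tie_prob qs (b + d) i) \<le>
      2 * (\<Sum>b<c. geo_sum (Suc a) b * tie_prob qs (b + d) i)"
    unfolding sum_distrib_left by (intro sum_mono step) simp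
  moreover have "geo_sum a c * tie_prob qs (c + d) (i - 1) \<le>
      2 * (geo_sum (Suc a) c * tie_prob qs (c + d) (i - 1))"
    by (intro step) simp
  ultimately show ?thesis by (cases "i = 0") (simp_all add: ps)
qed

section \<open>Galton-Watson processes without and with immigration\<close>

definition gw_tie :: "nat \<Rightarrow> nat \<Rightarrow> nat \<Rightarrow> nat \<Rightarrow> real" where
  "gw_tie k N = tie_prob (replicate N (k, 0))"

text \<open>The \<open>n\<close> generations with an immigrant are the sites between
  \<open>0\<close> and \<open>x\<close>; the other \<open>N\<close> lie beyond \<open>0\<close>. The
  barrier \<open>c\<close> is \<open>k\<close> or \<open>k - 1\<close>, depending on the sign of
  \<open>x\<close>.\<close>

definition bgw_tie :: "nat \<Rightarrow> nat \<Rightarrow> nat \<Rightarrow> nat \<Rightarrow> nat \<Rightarrow> nat \<Rightarrow> real" where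
  "bgw_tie c k N n = tie_prob (replicate n (c, 1) @ replicate N (k, 0))"

lemma gw_tie_nonneg [simp]: "0 \<le> gw_tie k N a i"
  by (simp add: gw_tie_def)

lemma bgw_tie_nonneg [simp]: "0 \<le> bgw_tie c k N n a i"
  by (simp add: bgw_tie_def)

lemma gw_tie_Suc:
  "gw_tie k (Suc N) a i = (\<Sum>b<k. geo_sum a b * gw_tie k N b i) +
     (if i = 0 then 0 else geo_sum a k * gw_tie k N k (i - 1))"
  by (simp add: gw_tie_def)

lemma bgw_tie_0: "bgw_tie c k N 0 a i = gw_tie k N a i"
  by (simp add: bgw_tie_def gw_tie_def)

lemma bgw_tie_Suc:
  "bgw_tie c k N (Suc n) a i = (\<Sum>b<c. geo_sum a b * bgw_tie c k N n (Suc b) i) +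
     (if i = 0 then 0 else geo_sum a c * bgw_tie c k N n (Suc c) (i - 1))"
  by (simp add: bgw_tie_def)

text \<open>An extinct process stays extinct for one more generation, and since \<open>k > 0\<close>
  this is no tie.\<close>

lemma gw_tie_le_Suc:
  assumes "0 < k" shows "gw_tie k N a i \<le> gw_tie k (Suc N) a i"
proof (induction N arbitrary: a i)
  case 0
  have "(\<Sum>b<k. geo_sum 0 b * gw_tie k 0 b 0) = (\<Sum>b<k. if b = 0 then 1 else 0)"
    by (intro sum.cong) (auto simp: geo_sum_0_left gw_tie_def)
  then have "gw_tie k 1 0 0 = 1" using assms by (simp add: gw_tie_Suc)
  then show ?case
    using gw_tie_nonneg[of k 1 a i] by (auto simp: gw_tie_def[of k 0])
next
  case (Suc N)
  then show ?case
    by (subst (1 2) gw_tie_Suc) (auto intro!: add_mono sum_mono mult_left_mono)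
qed

text \<open>Markov property at the first tie: the super-solution \<open>h\<close> dominates the
  probability of hitting \<open>k\<close> exactly, after which the process restarts from
  \<open>k\<close>.\<close>

lemma gw_tie_Suc_tie_le:
  assumes "0 < k"
    and h: "\<And>a. 0 \<le> h a" "\<And>a. (\<Sum>b<k. geo_sum a b * h b) + geo_sum a k \<le> h a"
  shows "gw_tie k N a (Suc i) \<le> h a * gw_tie k N k i"
proof (induction N arbitrary: a)
  case 0
  then show ?case using h(1) by (simp add: gw_tie_def)
next
  case (Suc N)
  have "gw_tie k (Suc N) a (Suc i) \<le>
      (\<Sum>b<k. geo_sum a b * (h b * gw_tie k N k i)) + geo_sum a k * gw_tie k N k i"
    unfolding gw_tie_Suc using Suc by (auto intro!: sum_mono mult_left_mono)
  also have "\<dots> = ((\<Sum>b<k. geo_sum a b * h b) + geo_sum a k) * gw_tie k N k i"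
    by (simp add: sum_distrib_right distrib_right mult.assoc)
  also have "\<dots> \<le> h a * gw_tie k (Suc N) k i"
    using h gw_tie_le_Suc[OF assms(1)] by (intro mult_mono) auto
  finally show ?case .
qed

text \<open>Every tie restarts the process at \<open>k\<close>, so the bound iterates; the final
  tie-free factor is moved from \<open>k\<close> to \<open>a\<close> by monotonicity.\<close>

lemma gw_tie_le:
  assumes "0 < k" "0 \<le> e"
    and tie: "\<And>a i. gw_tie k N a (Suc i) \<le> e * gw_tie k N k i" and "a \<le> k"
  shows "gw_tie k N a i \<le> e ^ i * gw_tie k N a 0"
proof (cases i)
  case (Suc j)
  have k: "gw_tie k N k i \<le> e ^ i * gw_tie k N k 0" for i
  proof (induction i)
    case (Suc i)
    then show ?case
      using tie[of k i] assms(2) by (simp add: mult.assoc) (meson mult_left_mono order.trans)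
  qed simp
  have "gw_tie k N a i \<le> e * (e ^ j * gw_tie k N k 0)"
    using tie[of a j] k[of j] assms(2) Suc by (meson mult_left_mono order.trans)
  also have "\<dots> \<le> e * (e ^ j * gw_tie k N a 0)"
    using assms by (intro mult_left_mono) (auto simp: gw_tie_def tie_prob_0_antimono)
  finally show ?thesis by (simp add: Suc)
qed simp

text \<open>
  The site next to a tie of the process with immigration may start from \<open>k + 1\<close>, one above the
  range in which \<open>gw_tie k N a 0 \<ge> gw_tie k N k 0\<close>; this costs a factor \<open>2\<close>.
\<close>

lemma gw_tie_le2:
  assumes "0 < k" "0 < N" "0 \<le> e"
    and tie: "\<And>a i. gw_tie k N a (Suc i) \<le> e * gw_tie k N k i" and "a \<le> Suc k"
  shows "gw_tie k N a i \<le> 2 * e ^ i * gw_tie k N a 0"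
proof (cases i)
  case (Suc j)
  have "gw_tie k N k 0 \<le> 2 * gw_tie k N (Suc k) 0"
    using assms(2) by (simp add: gw_tie_def tie_prob_Suc_ge)
  also have "\<dots> \<le> 2 * gw_tie k N a 0"
    using assms(5) by (simp add: gw_tie_def tie_prob_0_antimono)
  finally have k: "gw_tie k N k 0 \<le> 2 * gw_tie k N a 0" .
  have "gw_tie k N a i \<le> e * (e ^ j * gw_tie k N k 0)"
    using tie[of a j] gw_tie_le[OF assms(1,3) tie, of k j] assms(3) Suc
    by (metis mult_left_mono order.refl order.trans)
  also have "\<dots> \<le> e * (e ^ j * (2 * gw_tie k N a 0))"
    using assms(3) k by (intro mult_left_mono) auto
  finally show ?thesis by (simp add: Suc mult_ac)
qed simp

text \<open>The sum runs over the length of the immigration phase, that is, over the endpoint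
  \<open>x\<close>. After a tie within that phase the remaining length again ranges over an initial
  segment, so the sums satisfy a renewal recursion.\<close>

definition bgw_tie_sum :: "nat \<Rightarrow> nat \<Rightarrow> nat \<Rightarrow> nat \<Rightarrow> nat \<Rightarrow> nat \<Rightarrow> real" where
  "bgw_tie_sum c k N m a i = (\<Sum>n<m. bgw_tie c k N n a i)"

lemma bgw_tie_sum_nonneg [simp]: "0 \<le> bgw_tie_sum c k N m a i"
  by (simp add: bgw_tie_sum_def sum_nonneg)

lemma bgw_tie_sum_Suc:
  "bgw_tie_sum c k N (Suc m) a i = gw_tie k N a i +
     (\<Sum>b<c. geo_sum a b * bgw_tie_sum c k N m (Suc b) i) +
     (if i = 0 then 0 else geo_sum a c * bgw_tie_sum c k N m (Suc c) (i - 1))"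
  unfolding bgw_tie_sum_def sum.lessThan_Suc_shift
  by (auto simp: bgw_tie_0 bgw_tie_Suc sum.distrib sum_distrib_left intro: sum.swap)

lemma bgw_tie_sum_le_Suc: "bgw_tie_sum c k N m a i \<le> bgw_tie_sum c k N (Suc m) a i"
  by (simp add: bgw_tie_sum_def)

lemma bgw_tie_sum_0_antimono: "a \<le> a' \<Longrightarrow> bgw_tie_sum c k N m a' 0 \<le> bgw_tie_sum c k N m a 0"
  unfolding bgw_tie_sum_def bgw_tie_def by (intro sum_mono tie_prob_0_antimono)

text \<open>Either a tie occurs during the immigration phase and the process restarts from
  \<open>c + 1\<close>, or all ties come later and \<open>gw\<close> applies.\<close>

lemma bgw_tie_sum_Suc_tie_le:
  assumes gw: "\<And>a i. a \<le> Suc c \<Longrightarrow> gw_tie k N a i \<le> 2 * e ^ i * gw_tie k N a 0" and "0 \<le> e"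
    and h: "\<And>a. 0 \<le> h a"
      "\<And>a. a \<le> Suc c \<Longrightarrow> (\<Sum>b<c. geo_sum a b * h (Suc b)) + geo_sum a c \<le> h a"
    and "a \<le> Suc c"
  shows "bgw_tie_sum c k N m a (Suc i) \<le>
    h a * bgw_tie_sum c k N m (Suc c) i + 2 * e ^ Suc i * bgw_tie_sum c k N m a 0"
  using assms(5)
proof (induction m arbitrary: a)
  case 0
  then show ?case by (simp add: bgw_tie_sum_def)
next
  case (Suc m)
  let ?B = "bgw_tie_sum c k N m (Suc c) i"
  have "bgw_tie_sum c k N (Suc m) a (Suc i) \<le> 2 * e ^ Suc i * gw_tie k N a 0 +
     (\<Sum>b<c. geo_sum a b * (h (Suc b) * ?B + 2 * e ^ Suc i * bgw_tie_sum c k N m (Suc b) 0)) +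
     geo_sum a c * ?B"
    unfolding bgw_tie_sum_Suc
    by (intro add_mono gw Suc.prems sum_mono mult_left_mono Suc.IH) auto
  also have "\<dots> = ((\<Sum>b<c. geo_sum a b * h (Suc b)) + geo_sum a c) * ?B +
      2 * e ^ Suc i * (gw_tie k N a 0 + (\<Sum>b<c. geo_sum a b * bgw_tie_sum c k N m (Suc b) 0))"
    by (simp add: sum_distrib_left sum_distrib_right sum.distrib algebra_simps)
  also have "\<dots> \<le> h a * bgw_tie_sum c k N (Suc m) (Suc c) i +
      2 * e ^ Suc i * bgw_tie_sum c k N (Suc m) a 0"
  proof (intro add_mono mult_mono)
    show "(\<Sum>b<c. geo_sum a b * h (Suc b)) + geo_sum a c \<le> h a" using h(2) Suc.prems .
    show "?B \<le> bgw_tie_sum c k N (Suc m) (Suc c) i" by (rule bgw_tie_sum_le_Suc)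
    show "gw_tie k N a 0 + (\<Sum>b<c. geo_sum a b * bgw_tie_sum c k N m (Suc b) 0)
        \<le> bgw_tie_sum c k N (Suc m) a 0"
      unfolding bgw_tie_sum_Suc by simp
  qed (use h assms(2) in \<open>auto intro!: add_nonneg_nonneg sum_nonneg mult_nonneg_nonneg\<close>)
  finally show ?case .
qed

text \<open>Each tie multiplies by \<open>e\<close> and adds another term with constant 2; the
  constants thus grow as \<open>1, 3, 5, ...\<close>.\<close>

lemma bgw_tie_sum_le:
  assumes "0 \<le> e" and tie: "\<And>a i. a \<le> Suc c \<Longrightarrow> bgw_tie_sum c k N m a (Suc i) \<le>
      e * bgw_tie_sum c k N m (Suc c) i + 2 * e ^ Suc i * bgw_tie_sum c k N m a 0"
    and a: "a \<le> Suc c"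
  shows "bgw_tie_sum c k N m a i \<le> (1 + 2 * real i) * e ^ i * bgw_tie_sum c k N m a 0"
proof -
  have c: "bgw_tie_sum c k N m (Suc c) i \<le> (1 + 2 * real i) * e ^ i * bgw_tie_sum c k N m (Suc c) 0" for i
  proof (induction i)
    case (Suc i)
    have "bgw_tie_sum c k N m (Suc c) (Suc i) \<le>
        e * ((1 + 2 * real i) * e ^ i * bgw_tie_sum c k N m (Suc c) 0) +
        2 * e ^ Suc i * bgw_tie_sum c k N m (Suc c) 0"
      using tie[of "Suc c" i] mult_left_mono[OF Suc assms(1)] by simp
    then show ?case by (simp add: algebra_simps)
  qed simp
  show ?thesis
  proof (cases i)
    case (Suc j)
    have "bgw_tie_sum c k N m a i \<le>
        e * ((1 + 2 * real j) * e ^ j * bgw_tie_sum c k N m (Suc c) 0) +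
        2 * e ^ Suc j * bgw_tie_sum c k N m a 0"
      using tie[OF a, of j] mult_left_mono[OF c[of j] assms(1)] Suc by simp
    also have "\<dots> \<le> e * ((1 + 2 * real j) * e ^ j * bgw_tie_sum c k N m a 0) +
        2 * e ^ Suc j * bgw_tie_sum c k N m a 0"
      using a assms(1) by (intro add_mono mult_left_mono bgw_tie_sum_0_antimono) auto
    finally show ?thesis by (simp add: Suc algebra_simps)
  qed simp
qed

text \<open>
  The two summands stand for \<open>x \<ge> 0\<close> and \<open>x < 0\<close>. In the second one the process to the right of
  \<open>x\<close> counts upcrossings, which are one less than the downcrossings as long as the site is negative;
  hence the barrier \<open>k - 1\<close>.
\<close>

definition tie_weight :: "nat \<Rightarrow> nat \<Rightarrow> nat \<Rightarrow> nat \<Rightarrow> real" where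
  "tie_weight k N i j = gw_tie k N k i * bgw_tie_sum k k N (Suc N) k j +
     bgw_tie_sum (k - 1) k N (Suc N) k i * gw_tie k N (k - 1) j"

text \<open>The two sides of \<open>x\<close> enter as a product, so the costs of their ties
  multiply; only the side with immigration brings a linear constant.\<close>

lemma tie_weight_le:
  assumes k: "0 < k" "0 < N" and e: "0 \<le> e"
    and gw: "\<exists>h. (\<forall>a. 0 \<le> h a \<and> h a \<le> e) \<and> (\<forall>a. (\<Sum>b<k. geo_sum a b * h b) + geo_sum a k \<le> h a)"
    and bgw: "\<And>c. c = k \<or> c = k - 1 \<Longrightarrow> \<exists>h. (\<forall>a. 0 \<le> h a \<and> h a \<le> e) \<and>
        (\<forall>a \<le> Suc c. (\<Sum>b<c. geo_sum a b * h (Suc b)) + geo_sum a c \<le> h a)"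
  shows "tie_weight k N i j \<le> (1 + 2 * real (i + j)) * e ^ (i + j) * tie_weight k N 0 0"
proof -
  have tie: "gw_tie k N a (Suc i) \<le> e * gw_tie k N k i" for a i
  proof -
    obtain h where h: "\<And>a. 0 \<le> h a" "\<And>a. h a \<le> e" "\<And>a. (\<Sum>b<k. geo_sum a b * h b) + geo_sum a k \<le> h a"
      using gw by blast
    show ?thesis
      using gw_tie_Suc_tie_le[OF k(1) h(1,3), of N a i] h(2)
      by (meson gw_tie_nonneg mult_right_mono order.trans)
  qed
  have G: "gw_tie k N a i \<le> e ^ i * gw_tie k N a 0" if "a \<le> k" for a i
    using gw_tie_le[OF k(1) e tie that] .
  have B: "bgw_tie_sum c k N m k i \<le> (1 + 2 * real i) * e ^ i * bgw_tie_sum c k N m k 0"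
    if c: "c = k \<or> c = k - 1" for c m i
  proof (rule bgw_tie_sum_le[OF e])
    fix a i assume a: "a \<le> Suc c"
    obtain h where h: "\<And>a. 0 \<le> h a" "\<And>a. h a \<le> e"
      "\<And>a. a \<le> Suc c \<Longrightarrow> (\<Sum>b<c. geo_sum a b * h (Suc b)) + geo_sum a c \<le> h a"
      using bgw[OF c] by blast
    have "bgw_tie_sum c k N m a (Suc i) \<le>
        h a * bgw_tie_sum c k N m (Suc c) i + 2 * e ^ Suc i * bgw_tie_sum c k N m a 0"
      using c by (intro bgw_tie_sum_Suc_tie_le[OF gw_tie_le2[OF k e tie] e h(1,3) a]) auto
    also have "\<dots> \<le> e * bgw_tie_sum c k N m (Suc c) i + 2 * e ^ Suc i * bgw_tie_sum c k N m a 0"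
      by (intro add_right_mono mult_right_mono h(2)) simp
    finally show "bgw_tie_sum c k N m a (Suc i) \<le> \<dots>" .
  qed (use c k in auto)
  define C where "C = (1 + 2 * real (i + j)) * e ^ (i + j)"
  have "gw_tie k N k i * bgw_tie_sum k k N (Suc N) k j \<le>
      (e ^ i * gw_tie k N k 0) * ((1 + 2 * real j) * e ^ j * bgw_tie_sum k k N (Suc N) k 0)"
    using G[of k i] B[of k "Suc N" j] e by (intro mult_mono) auto
  also have "\<dots> = (1 + 2 * real j) * e ^ (i + j) * (gw_tie k N k 0 * bgw_tie_sum k k N (Suc N) k 0)"
    by (simp add: power_add)
  also have "\<dots> \<le> C * (gw_tie k N k 0 * bgw_tie_sum k k N (Suc N) k 0)"
    unfolding C_def using e by (intro mult_right_mono) auto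
  finally have 1: "gw_tie k N k i * bgw_tie_sum k k N (Suc N) k j \<le> \<dots>" .
  have "bgw_tie_sum (k - 1) k N (Suc N) k i * gw_tie k N (k - 1) j \<le>
      ((1 + 2 * real i) * e ^ i * bgw_tie_sum (k - 1) k N (Suc N) k 0) * (e ^ j * gw_tie k N (k - 1) 0)"
    using G[of "k - 1" j] B[of "k - 1" "Suc N" i] e by (intro mult_mono) auto
  also have "\<dots> = (1 + 2 * real i) * e ^ (i + j) *
      (bgw_tie_sum (k - 1) k N (Suc N) k 0 * gw_tie k N (k - 1) 0)"
    by (simp add: power_add)
  also have "\<dots> \<le> C * (bgw_tie_sum (k - 1) k N (Suc N) k 0 * gw_tie k N (k - 1) 0)"
    unfolding C_def using e by (intro mult_right_mono) auto
  finally have 2: "bgw_tie_sum (k - 1) k N (Suc N) k i * gw_tie k N (k - 1) j \<le> \<dots>" .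
  show ?thesis
    unfolding C_def[symmetric] tie_weight_def distrib_left using 1 2 by (rule add_mono)
qed

lemma eventually_tie_weight_le:
  "\<forall>\<^sub>F k in sequentially. \<forall>N i j. 0 < N \<longrightarrow>
     tie_weight k N i j \<le> (1 + 2 * real (i + j)) * (18 * real k powr (- 2 / 5)) ^ (i + j) * tie_weight k N 0 0"
proof -
  have "\<forall>\<^sub>F k in sequentially. \<exists>u m. 0 < u \<and> 0 < m \<and> real m * (real u + real m + 1) \<le> real (k - 1) \<and>
     hit_bound (k - 1) u m \<le> 9 * real (k - 1) powr (- 2 / 5)"
    using eventually_compose_filterlim[OF eventually_hit_bound filterlim_minus_const_nat_at_top[of 1]] .
  \<comment> \<open>The barrier \<open>k - 1\<close> also occurs; doubling 9 to 18 absorbs the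
    passage from \<open>k - 1\<close> to \<open>k\<close>.\<close>
  moreover have "\<forall>\<^sub>F k :: nat in sequentially. 9 * (real k - 1) powr (- 2 / 5) \<le> 18 * real k powr (- 2 / 5)"
    by real_asymp
  moreover have "\<forall>\<^sub>F k :: nat in sequentially. k \<ge> 3"
    by (rule eventually_ge_at_top)
  ultimately show ?thesis using eventually_hit_bound
  proof eventually_elim
    case (elim k)
    define e where "e = 18 * real k powr (- 2 / 5)"
    have e0: "0 \<le> e" by (simp add: e_def)
    from elim(4) obtain u m where um: "0 < u" "0 < m" "real m * (real u + real m + 1) \<le> real k"
      "hit_bound k u m \<le> 9 * real k powr (- 2 / 5)" by blast
    have um4: "hit_bound k u m \<le> e" unfolding e_def by (rule order.trans[OF um(4)]) simp
    from elim(1) obtain u' m' where um': "0 < u'" "0 < m'" "real m' * (real u' + real m' + 1) \<le> real (k - 1)"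
      "hit_bound (k - 1) u' m' \<le> 9 * real (k - 1) powr (- 2 / 5)" by blast
    have "real (k - 1) = real k - 1" using elim(3) by simp
    with um'(4) elim(2) have um4': "hit_bound (k - 1) u' m' \<le> e" by (simp add: e_def)
    have k: "2 \<le> k" "2 \<le> k - 1" "0 < k" using elim(3) by auto
    have gw: "\<exists>h. (\<forall>a. 0 \<le> h a \<and> h a \<le> e) \<and> (\<forall>a. (\<Sum>b<k. geo_sum a b * h b) + geo_sum a k \<le> h a)"
      using hit_super_solution[OF um(2,3) k(1) um(1)] um4 by (meson order.trans)
    have bgw: "\<exists>h. (\<forall>a. 0 \<le> h a \<and> h a \<le> e) \<and>
        (\<forall>a \<le> Suc c. (\<Sum>b<c. geo_sum a b * h (Suc b)) + geo_sum a c \<le> h a)" if "c = k \<or> c = k - 1" for c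
    proof -
      have "\<exists>u m. hit_bound c u m \<le> e \<and> 0 < m \<and> real m * (real u + real m + 1) \<le> real c \<and> 2 \<le> c"
        using that
      proof
        assume "c = k"
        then show ?thesis using um um4 k(1) by blast
      next
        assume "c = k - 1"
        then show ?thesis using um' um4' k(2) by blast
      qed
      then obtain u m where "hit_bound c u m \<le> e" "0 < m"
        "real m * (real u + real m + 1) \<le> real c" "2 \<le> c" by blast
      then show ?thesis
        using hit_super_solution_immigration[of m u c] by (meson order.trans)
    qed
    show ?case
      using tie_weight_le[OF k(3) _ e0 gw bgw] unfolding e_def by blast
  qed
qed

section \<open>Paths and departures from sites\<close>

type_synonym word = "bool list"

definition step_of :: "bool \<Rightarrow> int" where
  "step_of c = (if c then 1 else -1)"

fun endpoint :: "int \<Rightarrow> word \<Rightarrow> int" where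
  "endpoint p [] = p"
| "endpoint p (c # w) = endpoint (p + step_of c) w"

fun departures :: "int \<Rightarrow> int \<Rightarrow> word \<Rightarrow> word" where
  "departures y p [] = []"
| "departures y p (c # w) = (if y = p then [c] else []) @ departures y (p + step_of c) w"

lemma endpoint_append: "endpoint p (u @ v) = endpoint (endpoint p u) v"
  by (induction u arbitrary: p) auto

lemma departures_append: "departures y p (u @ v) = departures y p u @ departures y (endpoint p u) v"
  by (induction u arbitrary: p) auto

lemma departures_inject:
  assumes "\<And>y. departures y p u = departures y p v" shows "u = v"
  using assms
proof (induction u arbitrary: p v)
  case Nil
  then show ?case using Nil[of p] by (cases v) auto
next
  case (Cons c u)
  from Cons.prems[of p] obtain v' where v: "v = c # v'" by (cases v) auto
  have "departures y (p + step_of c) u = departures y (p + step_of c) v'" for y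
    using Cons.prems[of y] by (simp add: v split: if_splits)
  then show ?case using Cons.IH v by blast
qed

lemma of_bool_less_step_of:
  "(of_bool (y < p + step_of c) :: int) = of_bool (y < p) + of_bool (y = p \<and> c) - of_bool (y + 1 = p \<and> \<not> c)"
  by (auto simp: step_of_def)

text \<open>Up and down crossings of the edge between \<open>y\<close> and \<open>y + 1\<close>
  alternate, so their difference depends only on the sides of the two ends of the path.\<close>

lemma departures_cut:
  "int (count_list (departures y p w) True) - int (count_list (departures (y + 1) p w) False) =
     of_bool (y < endpoint p w) - of_bool (y < p)"
proof (induction w arbitrary: p)
  case (Cons c w)
  show ?case
    using Cons[of "p + step_of c", unfolded of_bool_less_step_of]
    by (cases c; cases "y = p"; cases "y + 1 = p") simp_all
qed simp

text \<open>After its last departure from \<open>y\<close> the path stays on one side of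
  \<open>y\<close>, the side of its endpoint.\<close>

lemma last_departures:
  assumes "y \<noteq> endpoint p w" "departures y p w \<noteq> []"
  shows "last (departures y p w) \<longleftrightarrow> y < endpoint p w"
  using assms
proof (induction w arbitrary: p)
  case (Cons c w)
  show ?case
  proof (cases "departures y (p + step_of c) w = []")
    case False
    then show ?thesis using Cons by simp
  next
    case True
    then have y: "y = p" using Cons.prems by (auto split: if_splits)
    \<comment> \<open>Changing sides after the first step would need another departure from
      \<open>y\<close>; the cuts at the two edges of \<open>y\<close> express this.\<close>
    have "count_list (departures y (p + step_of c) w) b = 0" for b using True by simp
    then show ?thesis
      using departures_cut[of y "p + step_of c" w] departures_cut[of "y - 1" "p + step_of c" w] Cons.prems y True
      by (auto simp: step_of_def of_bool_def split: if_splits)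
  qed
qed simp

lemma length_eq_sum_departures:
  assumes "finite Y" "\<And>y. y \<notin> Y \<Longrightarrow> departures y p w = []"
  shows "length w = (\<Sum>y\<in>Y. length (departures y p w))"
  using assms(2)
proof (induction w arbitrary: p)
  case (Cons c w)
  have "p \<in> Y" using Cons.prems[of p] by auto
  have "departures y (p + step_of c) w = []" if "y \<notin> Y" for y
    using Cons.prems[OF that] by (auto split: if_splits)
  then have "length w = (\<Sum>y\<in>Y. length (departures y (p + step_of c) w))" by (rule Cons.IH)
  moreover have "length (departures y p (c # w)) = (if y = p then 1 else 0) + length (departures y (p + step_of c) w)" for y
    by simp
  ultimately show ?case
    using assms(1) \<open>p \<in> Y\<close> by (simp only: sum.distrib sum.delta) simp
qed simp

lemma count_list_last: "w \<noteq> [] \<Longrightarrow> 0 < count_list w (last w)"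
  by (metis count_list_0_iff gr0I last_in_set)

text \<open>
  The walk that uses up the prescribed departures of each site one after the other can only stop
  at \<open>x\<close>, because of the balance of crossings; by the condition on the last departures it stops
  only after it has used all of them.
\<close>

lemma departures_surj:
  assumes "finite Y" "\<And>y. y \<notin> Y \<Longrightarrow> v y = []"
    and cut: "\<And>y. int (count_list (v y) True) - int (count_list (v (y + 1)) False) =
      of_bool (y < x) - of_bool (y < p)"
    and last: "\<And>y. y \<noteq> x \<Longrightarrow> v y \<noteq> [] \<Longrightarrow> last (v y) \<longleftrightarrow> y < x"
  shows "\<exists>w. endpoint p w = x \<and> (\<forall>y. departures y p w = v y)"
  using assms(2-)
proof (induction "\<Sum>y\<in>Y. length (v y)" arbitrary: v p rule: less_induct)
  case less
  show ?case
  proof (cases "v p")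
    case Nil
    \<comment> \<open>The walk is stuck at \<open>p\<close>: with no departures there, the two
      adjacent cuts force the target to be \<open>p\<close>.\<close>
    have px: "x = p"
      using less.prems(2)[of p] less.prems(2)[of "p - 1"] Nil
      by (auto simp: of_bool_def split: if_splits)
    \<comment> \<open>Outward from \<open>p\<close>: the last departure of a nonempty stack would
      point to the empty site next to it, giving that edge an unbalanced crossing.\<close>
    have "v (p + int n) = [] \<and> v (p - int n) = []" for n
    proof (induction n)
      case (Suc n)
      have "v (p + int (Suc n)) = []"
      proof (rule ccontr)
        assume ne: "v (p + int (Suc n)) \<noteq> []"
        then have "\<not> last (v (p + int (Suc n)))" using less.prems(3)[OF _ ne] px by simp
        then show False
          using count_list_last[OF ne] less.prems(2)[of "p + int n"] Suc px
          by (simp add: add.assoc add.commute[of 1])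
      qed
      moreover have "v (p - int (Suc n)) = []"
      proof (rule ccontr)
        assume ne: "v (p - int (Suc n)) \<noteq> []"
        then have "last (v (p - int (Suc n)))" using less.prems(3)[OF _ ne] px by simp
        then show False
          using count_list_last[OF ne] less.prems(2)[of "p - int (Suc n)"] Suc px
          by simp
      qed
      ultimately show ?case by simp
    qed (simp add: Nil)
    then have "v y = []" for y
      by (cases "p \<le> y") (metis add_diff_cancel_left' nat_0_le diff_ge_0_iff_ge add.commute diff_add_cancel,
        metis diff_diff_eq2 add_diff_cancel_left' nat_0_le diff_ge_0_iff_ge nle_le)
    then show ?thesis using px by (intro exI[of _ "[]"]) auto
  next
    case (Cons c u)
    define v' where "v' = v(p := u)"
    have pY: "p \<in> Y" using less.prems(1)[of p] Cons by auto
    have "(\<Sum>y\<in>Y. length (v' y)) < (\<Sum>y\<in>Y. length (v y))"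
    proof (rule sum_strict_mono_ex1)
      show "\<forall>y\<in>Y. length (v' y) \<le> length (v y)" by (simp add: v'_def Cons)
      show "\<exists>y\<in>Y. length (v' y) < length (v y)"
        by (rule bexI[OF _ pY]) (simp add: v'_def Cons)
    qed (rule assms(1))
    moreover have "v' y = []" if "y \<notin> Y" for y
      using that less.prems(1)[OF that] pY by (auto simp: v'_def)
    moreover have "int (count_list (v' y) True) - int (count_list (v' (y + 1)) False) =
      of_bool (y < x) - of_bool (y < p + step_of c)" for y
      using less.prems(2)[of y] Cons of_bool_less_step_of[of y p c]
      by (cases c; cases "y = p"; cases "y + 1 = p") (simp_all add: v'_def)
    moreover have "last (v' y) \<longleftrightarrow> y < x" if "y \<noteq> x" "v' y \<noteq> []" for y
      using less.prems(3)[OF that(1)] that Cons by (auto simp: v'_def split: if_splits)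
    ultimately obtain w where w: "endpoint (p + step_of c) w = x" "\<And>y. departures y (p + step_of c) w = v' y"
      using less.hyps[of v' "p + step_of c"] by blast
    have "departures y p (c # w) = v y" for y
      by (simp add: w v'_def Cons)
    then show ?thesis using w(1) by (intro exI[of _ "c # w"]) auto
  qed
qed

section \<open>Weights of departure words and of families of them\<close>

definition site_words :: "bool \<Rightarrow> nat \<Rightarrow> nat \<Rightarrow> word set" where
  "site_words c a b =
     {v. count_list v c = a \<and> count_list v (\<not> c) = b \<and> (v \<noteq> [] \<longrightarrow> last v = c)}"

lemma Cons_in_site_words:
  "d # u \<in> site_words c a b \<longleftrightarrow>
     (if d = c then 0 < a \<and> u \<in> site_words c (a - 1) b else 0 < b \<and> u \<noteq> [] \<and> u \<in> site_words c a (b - 1))"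
  by (cases a; cases b) (auto simp: site_words_def)

lemma Nil_in_site_words: "[] \<in> site_words c a b \<longleftrightarrow> a = 0 \<and> b = 0"
  by (auto simp: site_words_def)

lemma site_words_0: "site_words c 0 b = (if b = 0 then {[]} else {})"
proof (rule set_eqI)
  fix v
  have "v = []" if "v \<in> site_words c 0 b"
  proof (rule ccontr)
    assume "v \<noteq> []"
    with that count_list_last[OF this] show False by (simp add: site_words_def)
  qed
  then show "v \<in> site_words c 0 b \<longleftrightarrow> v \<in> (if b = 0 then {[]} else {})"
    by (cases "v = []") (auto simp: Nil_in_site_words)
qed

lemma site_words_Suc_0: "site_words c (Suc a) 0 = (#) c ` site_words c a 0"
proof (rule set_eqI)
  show "v \<in> site_words c (Suc a) 0 \<longleftrightarrow> v \<in> (#) c ` site_words c a 0" for v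
    by (cases v) (auto simp: Cons_in_site_words Nil_in_site_words)
qed

lemma site_words_Suc_Suc:
  "site_words c (Suc a) (Suc b) =
     (#) c ` site_words c a (Suc b) \<union> (#) (\<not> c) ` site_words c (Suc a) b"
proof (rule set_eqI)
  show "v \<in> site_words c (Suc a) (Suc b) \<longleftrightarrow>
      v \<in> (#) c ` site_words c a (Suc b) \<union> (#) (\<not> c) ` site_words c (Suc a) b" for v
    by (cases v) (auto simp: Cons_in_site_words Nil_in_site_words)
qed

text \<open>A branching step at one site: the \<open>a\<close> steps in direction \<open>c\<close>
  lead back towards \<open>x\<close>, and each one ends a geometric run of steps away from
  \<open>x\<close>. Splitting by the first letter reproduces the recursion of
  \<open>geo_sum\<close>.\<close>

lemma sum_site_words:
  "finite (site_words c a b) \<and> (\<Sum>v\<in>site_words c a b. (1 / 2) ^ length v) = geo_sum a b"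
proof (induction a arbitrary: b)
  case 0
  then show ?case by (simp add: site_words_0 geo_sum_0_left)
next
  case (Suc a)
  show ?case
  proof (induction b)
    case 0
    then show ?case
      using Suc by (simp add: site_words_Suc_0 geo_sum_Suc_0 sum.reindex sum_divide_distrib[symmetric])
  next
    case (Suc b)
    have "(\<Sum>v\<in>site_words c (Suc a) (Suc b). (1 / 2) ^ length v) =
        (\<Sum>v\<in>(#) c ` site_words c a (Suc b). (1 / 2) ^ length v) +
        (\<Sum>v\<in>(#) (\<not> c) ` site_words c (Suc a) b. (1 / 2) ^ length v :: real)"
      unfolding site_words_Suc_Suc using Suc \<open>\<And>b. finite (site_words c a b) \<and> _ b\<close>
      by (intro sum.union_disjoint) auto
    then show ?case
      using Suc \<open>\<And>b. finite (site_words c a b) \<and> _ b\<close>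
      by (simp add: site_words_Suc_Suc geo_sum_Suc_Suc sum.reindex sum_divide_distrib[symmetric])
  qed
qed

fun tie_words :: "bool \<Rightarrow> (nat \<times> nat) list \<Rightarrow> nat \<Rightarrow> nat \<Rightarrow> word list set" where
  "tie_words c [] a i = (if a = 0 \<and> i = 0 then {[]} else {})"
| "tie_words c ((m, d) # ps) a i =
     (\<Union>b<m. (\<lambda>(v, vs). v # vs) ` (site_words c a b \<times> tie_words c ps (b + d) i)) \<union>
     (if i = 0 then {}
      else (\<lambda>(v, vs). v # vs) ` (site_words c a m \<times> tie_words c ps (m + d) (i - 1)))"


lemma sum_Cons_image:
  fixes A :: "word set"
  shows "(\<Sum>vs\<in>(\<lambda>(v, vs). v # vs) ` (A \<times> B). (1 / 2) ^ length (concat vs)) =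
     (\<Sum>v\<in>A. (1 / 2) ^ length v) * (\<Sum>vs\<in>B. (1 / 2) ^ length (concat vs) :: real)"
proof -
  have "inj_on (\<lambda>(v, vs). v # vs) (A \<times> B)" by (auto simp: inj_on_def)
  then show ?thesis
    by (simp add: sum.reindex sum_product sum.cartesian_product power_add case_prod_unfold)
qed

text \<open>The pieces for different \<open>b\<close> are disjoint, as \<open>b\<close> is read off
  from the first word; within a piece the weights multiply.\<close>

lemma sum_tie_words:
  "finite (tie_words c ps a i) \<and>
   (\<Sum>vs\<in>tie_words c ps a i. (1 / 2) ^ length (concat vs)) = tie_prob ps a i"
proof (induction ps arbitrary: a i)
  case (Cons p ps)
  obtain m d where p: "p = (m, d)" by (cases p)
  define T where "T b i = (\<lambda>(v, vs). v # vs) ` (site_words c a b \<times> tie_words c ps (b + d) i)" for b i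
  have fin: "finite (T b i)" for b i
    unfolding T_def using Cons sum_site_words by (intro finite_imageI finite_cartesian_product) auto
  have disj: "T b i \<inter> T b' i' = {}" if "b \<noteq> b'" for b b' i i'
    using that by (auto simp: T_def site_words_def)
  have sum: "(\<Sum>vs\<in>T b i. (1 / 2) ^ length (concat vs)) = geo_sum a b * tie_prob ps (b + d) i" for b i
    unfolding T_def sum_Cons_image using Cons sum_site_words by simp
  have less: "(\<Sum>vs\<in>(\<Union>b<m. T b i). (1 / 2) ^ length (concat vs)) =
      (\<Sum>b<m. geo_sum a b * tie_prob ps (b + d) i)"
    by (subst sum.UNION_disjoint) (use fin disj in \<open>simp_all add: sum\<close>)
  have words: "tie_words c (p # ps) a i = (\<Union>b<m. T b i) \<union> (if i = 0 then {} else T m (i - 1))"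
    by (simp add: p T_def)
  show ?case
  proof (cases "i = 0")
    case True
    then show ?thesis unfolding words using less fin by (simp add: p)
  next
    case False
    have "(\<Union>b<m. T b i) \<inter> T m (i - 1) = {}"
      unfolding Int_UN_distrib2[symmetric] using disj[of _ m i "i - 1"] by fast
    then have "(\<Sum>vs\<in>(\<Union>b<m. T b i) \<union> T m (i - 1). (1 / 2 :: real) ^ length (concat vs)) =
        (\<Sum>b<m. geo_sum a b * tie_prob ps (b + d) i) + geo_sum a m * tie_prob ps (m + d) (i - 1)"
      by (subst sum.union_disjoint) (use fin in \<open>simp_all add: less sum\<close>)
    then show ?thesis unfolding words using False fin by (simp add: p)
  qed
qed simp

lemma Cons_in_tie_words:
  "v # vs \<in> tie_words c ((m, d) # ps) a i \<longleftrightarrow>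
     count_list v c = a \<and> (v \<noteq> [] \<longrightarrow> last v = c) \<and>
     (count_list v (\<not> c) < m \<and> vs \<in> tie_words c ps (count_list v (\<not> c) + d) i \<or>
      count_list v (\<not> c) = m \<and> 0 < i \<and> vs \<in> tie_words c ps (count_list v (\<not> c) + d) (i - 1))"
proof -
  have *: "v # vs \<in> (\<lambda>(v, vs). v # vs) ` (A \<times> B) \<longleftrightarrow> v \<in> A \<and> vs \<in> B" for A B
    by auto
  have "v # vs \<in> tie_words c ((m, d) # ps) a i \<longleftrightarrow>
     (\<exists>b<m. v \<in> site_words c a b \<and> vs \<in> tie_words c ps (b + d) i) \<or>
     0 < i \<and> v \<in> site_words c a m \<and> vs \<in> tie_words c ps (m + d) (i - 1)"
    by (simp only: tie_words.simps Un_iff UN_iff * lessThan_iff Bex_def) (cases "i = 0"; simp add: *)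
  then show ?thesis unfolding site_words_def by blast
qed

lemma length_tie_words: "vs \<in> tie_words c ps a i \<Longrightarrow> length vs = length ps"
  by (induction ps arbitrary: a i vs) (auto split: if_splits)

lemma all_nat_split: "(\<forall>j :: nat. P j) \<longleftrightarrow> P 0 \<and> (\<forall>j. P (Suc j))"
  by (metis not0_implies_Suc)

lemma card_Collect_split:
  assumes "finite {j :: nat. P j}"
  shows "card {j. P j} = of_bool (P 0) + card {j. P (Suc j)}"
proof -
  have fin: "finite {j. P (Suc j)}"
    using finite_vimageI[OF assms, of Suc] by (simp add: vimage_def)
  have "{j. P j} = (if P 0 then {0} else {}) \<union> Suc ` {j. P (Suc j)}"
    by (auto simp: image_iff) (metis not0_implies_Suc)+
  then have "card {j. P j} = card ((if P 0 then {0} else {}) \<union> Suc ` {j. P (Suc j)})" by simp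
  also have "\<dots> = card (if P 0 then {0 :: nat} else {}) + card (Suc ` {j. P (Suc j)})"
    using fin by (intro card_Un_disjoint) auto
  also have "\<dots> = of_bool (P 0) + card {j. P (Suc j)}" by (simp add: card_image)
  finally show ?thesis .
qed

text \<open>Peeling off generations turns the recursion into conditions on each of them. Extending
  \<open>V\<close> by empty words, with no immigrants and positive barriers, turns extinction into
  an instance of the balance equation, so all \<open>j\<close> can be treated alike.\<close>

lemma map_in_tie_words_iff:
  assumes "\<And>j. n \<le> j \<Longrightarrow> V j = [] \<and> d j = 0 \<and> 0 < m j"
  shows "map V [0..<n] \<in> tie_words c (map (\<lambda>j. (m j, d j)) [0..<n]) a i \<longleftrightarrow>
    count_list (V 0) c = a \<and>
    (\<forall>j. count_list (V (Suc j)) c = count_list (V j) (\<not> c) + d j) \<and>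
    (\<forall>j. V j \<noteq> [] \<longrightarrow> last (V j) = c) \<and>
    (\<forall>j. count_list (V j) (\<not> c) \<le> m j) \<and>
    card {j. count_list (V j) (\<not> c) = m j} = i"
  using assms
proof (induction n arbitrary: V d m a i)
  case 0
  then have nil: "V j = []" "d j = 0" for j by auto
  have "{j. m j = 0} = {}" using 0 by auto
  from arg_cong[OF this, of card] have "card {j. m j = 0} = 0" by (simp only: card.empty)
  note card = this
  show ?case by (simp add: nil card)
next
  case (Suc n)
  let ?b = "count_list (V 0) (\<not> c)"
  have IH: "map (\<lambda>j. V (Suc j)) [0..<n] \<in> tie_words c (map (\<lambda>j. (m (Suc j), d (Suc j))) [0..<n]) a' i' \<longleftrightarrow>
    count_list (V (Suc 0)) c = a' \<and>
    (\<forall>j. count_list (V (Suc (Suc j))) c = count_list (V (Suc j)) (\<not> c) + d (Suc j)) \<and>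
    (\<forall>j. V (Suc j) \<noteq> [] \<longrightarrow> last (V (Suc j)) = c) \<and>
    (\<forall>j. count_list (V (Suc j)) (\<not> c) \<le> m (Suc j)) \<and>
    card {j. count_list (V (Suc j)) (\<not> c) = m (Suc j)} = i'" for a' i'
    by (rule Suc.IH) (rule Suc.prems, simp)
  have "finite {j. count_list (V j) (\<not> c) = m j}"
  proof (rule finite_subset)
    show "{j. count_list (V j) (\<not> c) = m j} \<subseteq> {..Suc n}"
    proof
      fix j assume "j \<in> {j. count_list (V j) (\<not> c) = m j}"
      then show "j \<in> {..Suc n}" using Suc.prems[of j] by (cases "Suc n \<le> j") auto
    qed
  qed simp
  then have card: "card {j. count_list (V j) (\<not> c) = m j} =
      of_bool (?b = m 0) + card {j. count_list (V (Suc j)) (\<not> c) = m (Suc j)}"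
    by (rule card_Collect_split)
  have "map V [0..<Suc n] = V 0 # map (\<lambda>j. V (Suc j)) [0..<n]"
    "map (\<lambda>j. (m j, d j)) [0..<Suc n] = (m 0, d 0) # map (\<lambda>j. (m (Suc j), d (Suc j))) [0..<n]"
    by (simp_all add: map_upt_Suc del: upt_Suc)
  note split = this
  have "map V [0..<Suc n] \<in> tie_words c (map (\<lambda>j. (m j, d j)) [0..<Suc n]) a i \<longleftrightarrow>
     count_list (V 0) c = a \<and> (V 0 \<noteq> [] \<longrightarrow> last (V 0) = c) \<and>
     (?b < m 0 \<and> map (\<lambda>j. V (Suc j)) [0..<n] \<in>
          tie_words c (map (\<lambda>j. (m (Suc j), d (Suc j))) [0..<n]) (?b + d 0) i \<or>
      ?b = m 0 \<and> 0 < i \<and> map (\<lambda>j. V (Suc j)) [0..<n] \<in>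
          tie_words c (map (\<lambda>j. (m (Suc j), d (Suc j))) [0..<n]) (?b + d 0) (i - 1))"
    unfolding split Cons_in_tie_words by (rule refl)
  also have "\<dots> \<longleftrightarrow> count_list (V 0) c = a \<and>
     (V 0 \<noteq> [] \<longrightarrow> last (V 0) = c) \<and> ?b \<le> m 0 \<and>
     count_list (V (Suc 0)) c = ?b + d 0 \<and>
     (\<forall>j. count_list (V (Suc (Suc j))) c = count_list (V (Suc j)) (\<not> c) + d (Suc j)) \<and>
     (\<forall>j. V (Suc j) \<noteq> [] \<longrightarrow> last (V (Suc j)) = c) \<and>
     (\<forall>j. count_list (V (Suc j)) (\<not> c) \<le> m (Suc j)) \<and>
     card {j. count_list (V j) (\<not> c) = m j} = i"
  proof (cases "?b = m 0")
    case True
    then have "0 < i \<and> card {j. count_list (V (Suc j)) (\<not> c) = m (Suc j)} = i - 1 \<longleftrightarrow>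
        card {j. count_list (V j) (\<not> c) = m j} = i"
      unfolding card by auto
    moreover have "?b \<le> m 0" "\<not> ?b < m 0" using True by auto
    ultimately show ?thesis unfolding IH using True by blast
  next
    case False
    then have "card {j. count_list (V (Suc j)) (\<not> c) = m (Suc j)} = i \<longleftrightarrow>
        card {j. count_list (V j) (\<not> c) = m j} = i"
      unfolding card by simp
    then show ?thesis unfolding IH le_less using False by blast
  qed
  finally show ?case
    unfolding all_nat_split[of "\<lambda>j. count_list (V (Suc j)) c = count_list (V j) (\<not> c) + d j"]
      all_nat_split[of "\<lambda>j. V j \<noteq> [] \<longrightarrow> last (V j) = c"]
      all_nat_split[of "\<lambda>j. count_list (V j) (\<not> c) \<le> m j"]
    by blast
qed

section \<open>Decomposition of a path at its endpoint\<close>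

definition downs :: "int \<Rightarrow> word \<Rightarrow> nat" where
  "downs y w = count_list (departures (y + 1) 0 w) False"

definition tie_paths :: "nat \<Rightarrow> int \<Rightarrow> nat \<Rightarrow> nat \<Rightarrow> word set" where
  "tie_paths k x i j = {w. w \<noteq> [] \<and> \<not> last w \<and> endpoint 0 w = x \<and> downs x w = k \<and> (\<forall>y. downs y w \<le> k) \<and>
     card {y. x < y \<and> downs y w = k} = i \<and> card {y. y < x \<and> downs y w = k} = j}"

text \<open>A finite window turns the family of departures into two lists of fixed lengths.\<close>

definition window_paths :: "nat \<Rightarrow> int \<Rightarrow> nat \<Rightarrow> nat \<Rightarrow> nat \<Rightarrow> nat \<Rightarrow> word set" where
  "window_paths k x i j l r =
     {w \<in> tie_paths k x i j. \<forall>y. departures y 0 w \<noteq> [] \<longrightarrow> x - int l < y \<and> y \<le> x + int r}"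

text \<open>
  The condition on the last departures says that the final step goes down from \<open>x + 1\<close> to \<open>x\<close>.
\<close>

definition path_family :: "int \<Rightarrow> (int \<Rightarrow> word) \<Rightarrow> bool" where
  "path_family x v \<longleftrightarrow>
     (\<forall>y. int (count_list (v y) True) - int (count_list (v (y + 1)) False) =
        of_bool (y < x) - of_bool (y < 0)) \<and>
     (\<forall>y. v y \<noteq> [] \<longrightarrow> last (v y) = (y \<le> x))"

text \<open>The path without its final step ends at \<open>x + 1\<close>, which settles the last
  departures of all other sites; the final step settles \<open>x + 1\<close>.\<close>

lemma path_family_departures:
  assumes "w \<noteq> []" "\<not> last w" "endpoint 0 w = x"
  shows "path_family x (\<lambda>y. departures y 0 w)"
proof -
  obtain u where w: "w = u @ [False]"
    using assms by (cases w rule: rev_cases) auto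
  have u: "endpoint 0 u = x + 1" using assms(3) by (simp add: w endpoint_append step_of_def)
  show ?thesis unfolding path_family_def
  proof (intro conjI allI impI)
    show "int (count_list (departures y 0 w) True) - int (count_list (departures (y + 1) 0 w) False) =
        of_bool (y < x) - of_bool (y < 0)" for y
      using departures_cut[of y 0 w] assms(3) by simp
    show "last (departures y 0 w) = (y \<le> x)" if "departures y 0 w \<noteq> []" for y
      using that last_departures[of y 0 u] by (cases "y = x + 1") (auto simp: w departures_append u)
  qed
qed

text \<open>Conversely, the final downward departure is removed from \<open>x + 1\<close>, a path to
  \<open>x + 1\<close> is built from the rest, and the step is appended.\<close>

lemma path_family_surj:
  assumes v: "path_family x v" "v (x + 1) \<noteq> []" and "finite Y" "\<And>y. y \<notin> Y \<Longrightarrow> v y = []"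
  shows "\<exists>w. w \<noteq> [] \<and> \<not> last w \<and> endpoint 0 w = x \<and> (\<forall>y. departures y 0 w = v y)"
proof -
  obtain u where u: "v (x + 1) = u @ [False]"
  proof (cases "v (x + 1)" rule: rev_cases)
    case (snoc u c)
    have "last (v (x + 1)) = (x + 1 \<le> x)" using v unfolding path_family_def by blast
    with snoc show thesis using that by simp
  qed (use v in simp)
  define v' where "v' = v(x + 1 := u)"
  have cut: "int (count_list (v y) True) - int (count_list (v (y + 1)) False) =
        of_bool (y < x) - of_bool (y < 0)" for y
    using v by (simp add: path_family_def)
  have "\<exists>w. endpoint 0 w = x + 1 \<and> (\<forall>y. departures y 0 w = v' y)"
  proof (rule departures_surj[OF assms(3)])
    show "v' y = []" if "y \<notin> Y" for y
      using assms(4)[OF that] u by (auto simp: v'_def)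
    show "int (count_list (v' y) True) - int (count_list (v' (y + 1)) False) =
        of_bool (y < x + 1) - of_bool (y < 0)" for y
      using cut[of y] u by (cases "y = x"; cases "y = x + 1") (simp_all add: v'_def)
    show "last (v' y) = (y < x + 1)" if "y \<noteq> x + 1" "v' y \<noteq> []" for y
      using v that by (simp add: path_family_def v'_def)
  qed
  then obtain w where w: "endpoint 0 w = x + 1" "\<And>y. departures y 0 w = v' y" by blast
  show ?thesis
    using w u by (intro exI[of _ "w @ [False]"]) (auto simp: endpoint_append departures_append step_of_def v'_def)
qed

text \<open>
  By balance, \<open>y\<close> has \<open>D(y) + [y < x] - [y < 0]\<close> upward departures, where \<open>D(y)\<close> counts the
  downcrossings of \<open>y\<close>. Between \<open>0\<close> and \<open>x\<close> the correction is the immigrant. To the right of \<open>x\<close>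
  the process is the number of upward departures before the correction, which lowers the barrier.
\<close>

definition right_params :: "nat \<Rightarrow> int \<Rightarrow> nat \<Rightarrow> (nat \<times> nat) list" where
  "right_params k x r =
     map (\<lambda>j. (k - of_bool (x + 1 + int j < 0), of_bool (x + 1 + int j < 0))) [0..<r]"

definition left_params :: "nat \<Rightarrow> int \<Rightarrow> nat \<Rightarrow> (nat \<times> nat) list" where
  "left_params k x l = map (\<lambda>j. (k, of_bool (0 \<le> x - int j - 1))) [0..<l]"

lemma all_greater_iff: "(\<forall>j. P (x + 1 + int j)) \<longleftrightarrow> (\<forall>y > x. P y)"
proof safe
  fix y assume *: "\<forall>j. P (x + 1 + int j)" "x < y"
  then show "P y" using *(1)[rule_format, of "nat (y - x - 1)"] by simp
qed auto

lemma all_le_iff: "(\<forall>j. P (x - int j)) \<longleftrightarrow> (\<forall>y \<le> x. P y)"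
proof safe
  fix y assume *: "\<forall>j. P (x - int j)" "y \<le> x"
  then show "P y" using *(1)[rule_format, of "nat (x - y)"] by simp
qed auto

lemma all_less_iff: "(\<forall>j. P (x - 1 - int j)) \<longleftrightarrow> (\<forall>y < x. P y)"
  using all_le_iff[of P "x - 1"] by simp

lemma card_greater: "card {j. P (x + 1 + int j)} = card {y. x < y \<and> P y}"
proof (rule bij_betw_same_card[of "\<lambda>j. x + 1 + int j"])
  show "bij_betw (\<lambda>j. x + 1 + int j) {j. P (x + 1 + int j)} {y. x < y \<and> P y}"
    by (rule bij_betw_byWitness[of _ "\<lambda>y. nat (y - x - 1)"]) auto
qed

lemma card_less: "card {j. P (x - 1 - int j)} = card {y. y < x \<and> P y}"
proof (rule bij_betw_same_card[of "\<lambda>j. x - 1 - int j"])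
  show "bij_betw (\<lambda>j. x - 1 - int j) {j. P (x - 1 - int j)} {y. y < x \<and> P y}"
    by (rule bij_betw_byWitness[of _ "\<lambda>y. nat (x - 1 - y)"]) auto
qed

text \<open>Generation \<open>j\<close> is the site \<open>x + 1 + j\<close>: its downward
  departures are the individuals, its upward departures their offspring.\<close>

lemma right_in_tie_words_iff:
  assumes "0 < k" "0 \<le> x + 1 + int r" "\<forall>y > x + int r. v y = []"
  shows "map (\<lambda>j. v (x + 1 + int j)) [0..<r] \<in> tie_words False (right_params k x r) k i \<longleftrightarrow>
    count_list (v (x + 1)) False = k \<and>
    (\<forall>y > x. count_list (v (y + 1)) False = count_list (v y) True + of_bool (y < 0)) \<and>
    (\<forall>y > x. v y \<noteq> [] \<longrightarrow> \<not> last (v y)) \<and>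
    (\<forall>y > x. count_list (v (y + 1)) False \<le> k) \<and>
    card {y. x < y \<and> count_list (v (y + 1)) False = k} = i"
proof -
  let ?d = "\<lambda>j. of_bool (x + 1 + int j < 0) :: nat"
  have "map (\<lambda>j. v (x + 1 + int j)) [0..<r] \<in> tie_words False (right_params k x r) k i \<longleftrightarrow>
    count_list (v (x + 1 + int 0)) False = k \<and>
    (\<forall>j. count_list (v (x + 1 + int (Suc j))) False = count_list (v (x + 1 + int j)) (\<not> False) + ?d j) \<and>
    (\<forall>j. v (x + 1 + int j) \<noteq> [] \<longrightarrow> last (v (x + 1 + int j)) = False) \<and>
    (\<forall>j. count_list (v (x + 1 + int j)) (\<not> False) \<le> k - ?d j) \<and>
    card {j. count_list (v (x + 1 + int j)) (\<not> False) = k - ?d j} = i"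
    unfolding right_params_def by (rule map_in_tie_words_iff) (use assms in auto)
  \<comment> \<open>By the balance equation the lowered barrier for upward departures is the barrier
    \<open>k\<close> for the downward departures of the next site; \<open>0 < k\<close> makes the
    subtraction exact.\<close>
  also have "\<dots> \<longleftrightarrow> count_list (v (x + 1)) False = k \<and>
    (\<forall>j. count_list (v ((x + 1 + int j) + 1)) False = count_list (v (x + 1 + int j)) True + ?d j) \<and>
    (\<forall>j. v (x + 1 + int j) \<noteq> [] \<longrightarrow> \<not> last (v (x + 1 + int j))) \<and>
    (\<forall>j. count_list (v ((x + 1 + int j) + 1)) False \<le> k) \<and>
    card {j. count_list (v ((x + 1 + int j) + 1)) False = k} = i"
  proof -
    have "count_list (v (x + 1 + int j)) True \<le> k - ?d j \<longleftrightarrow> count_list (v ((x + 1 + int j) + 1)) False \<le> k"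
      "count_list (v (x + 1 + int j)) True = k - ?d j \<longleftrightarrow> count_list (v ((x + 1 + int j) + 1)) False = k"
      if "\<forall>j. count_list (v ((x + 1 + int j) + 1)) False = count_list (v (x + 1 + int j)) True + ?d j" for j
      using that[rule_format, of j] assms(1) by auto
    moreover have "x + 1 + int (Suc j) = (x + 1 + int j) + 1" for j by simp
    ultimately show ?thesis by (simp cong: conj_cong)
  qed
  finally show ?thesis
    unfolding all_greater_iff[of "\<lambda>y. count_list (v (y + 1)) False = count_list (v y) True + of_bool (y < 0)"]
      all_greater_iff[of "\<lambda>y. v y \<noteq> [] \<longrightarrow> \<not> last (v y)"]
      all_greater_iff[of "\<lambda>y. count_list (v (y + 1)) False \<le> k"]
      card_greater[of "\<lambda>y. count_list (v (y + 1)) False = k"] .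
qed

text \<open>Directions are exchanged: individuals go up, offspring go down. The offspring of
  \<open>y\<close> are already the downcrossings of \<open>y - 1\<close>, so the barrier needs no
  correction.\<close>

lemma left_in_tie_words_iff:
  assumes "0 < k" "x \<le> int l" "\<forall>y \<le> x - int l. v y = []"
  shows "map (\<lambda>j. v (x - int j)) [0..<l] \<in> tie_words True (left_params k x l) (k - of_bool (x < 0)) i \<longleftrightarrow>
    count_list (v x) True = k - of_bool (x < 0) \<and>
    (\<forall>y < x. count_list (v y) True = count_list (v (y + 1)) False + of_bool (0 \<le> y)) \<and>
    (\<forall>y \<le> x. v y \<noteq> [] \<longrightarrow> last (v y)) \<and>
    (\<forall>y < x. count_list (v (y + 1)) False \<le> k) \<and>
    card {y. y < x \<and> count_list (v (y + 1)) False = k} = i"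
proof -
  have "map (\<lambda>j. v (x - int j)) [0..<l] \<in> tie_words True (left_params k x l) (k - of_bool (x < 0)) i \<longleftrightarrow>
    count_list (v (x - int 0)) True = k - of_bool (x < 0) \<and>
    (\<forall>j. count_list (v (x - int (Suc j))) True =
       count_list (v (x - int j)) (\<not> True) + of_bool (0 \<le> x - int j - 1)) \<and>
    (\<forall>j. v (x - int j) \<noteq> [] \<longrightarrow> last (v (x - int j)) = True) \<and>
    (\<forall>j. count_list (v (x - int j)) (\<not> True) \<le> k) \<and>
    card {j. count_list (v (x - int j)) (\<not> True) = k} = i"
    unfolding left_params_def by (rule map_in_tie_words_iff) (use assms in auto)
  also have "\<dots> \<longleftrightarrow> count_list (v x) True = k - of_bool (x < 0) \<and>
    (\<forall>j. count_list (v (x - 1 - int j)) True =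
       count_list (v ((x - 1 - int j) + 1)) False + of_bool (0 \<le> x - 1 - int j)) \<and>
    (\<forall>j. v (x - int j) \<noteq> [] \<longrightarrow> last (v (x - int j))) \<and>
    (\<forall>j. count_list (v ((x - 1 - int j) + 1)) False \<le> k) \<and>
    card {j. count_list (v ((x - 1 - int j) + 1)) False = k} = i"
  proof -
    have E: "x - int (Suc j) = x - 1 - int j" "x - int j - 1 = x - 1 - int j" "(x - 1 - int j) + 1 = x - int j" for j
      by auto
    show ?thesis unfolding E by simp
  qed
  finally show ?thesis
    unfolding all_less_iff[of "\<lambda>y. count_list (v y) True = count_list (v (y + 1)) False + of_bool (0 \<le> y)"]
      all_le_iff[of "\<lambda>y. v y \<noteq> [] \<longrightarrow> last (v y)"]
      all_less_iff[of "\<lambda>y. count_list (v (y + 1)) False \<le> k"]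
      card_less[of "\<lambda>y. count_list (v (y + 1)) False = k"] .
qed

text \<open>The balance equations below and above \<open>x\<close> involve separate stacks, coupled
  only by the fixed number \<open>k\<close> of downcrossings of \<open>x\<close>. The equation at
  \<open>x\<close> gives the initial value on the left.\<close>

lemma path_family_iff:
  assumes "0 < k" "x \<le> int l" "0 \<le> x + 1 + int r"
    and "\<forall>y > x + int r. v y = []" "\<forall>y \<le> x - int l. v y = []"
  shows "path_family x v \<and> count_list (v (x + 1)) False = k \<and> (\<forall>y. count_list (v (y + 1)) False \<le> k) \<and>
      card {y. x < y \<and> count_list (v (y + 1)) False = k} = i \<and>
      card {y. y < x \<and> count_list (v (y + 1)) False = k} = j \<longleftrightarrow>
    map (\<lambda>j. v (x - int j)) [0..<l] \<in> tie_words True (left_params k x l) (k - of_bool (x < 0)) j \<and>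
    map (\<lambda>j. v (x + 1 + int j)) [0..<r] \<in> tie_words False (right_params k x r) k i"
proof -
  have split: "(\<forall>y. P y) \<longleftrightarrow> P x \<and> (\<forall>y < x. P y) \<and> (\<forall>y > x. P y)" for P :: "int \<Rightarrow> bool"
    using linorder_less_linear[of _ x] by blast
  have last: "(\<forall>y. v y \<noteq> [] \<longrightarrow> last (v y) = (y \<le> x)) \<longleftrightarrow>
      (\<forall>y \<le> x. v y \<noteq> [] \<longrightarrow> last (v y)) \<and> (\<forall>y > x. v y \<noteq> [] \<longrightarrow> \<not> last (v y))"
    by (meson not_le)
  have cut_x: "int (count_list (v x) True) - int (count_list (v (x + 1)) False) =
        of_bool (x < x) - of_bool (x < 0) \<longleftrightarrow> count_list (v x) True = k - of_bool (x < 0)"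
    if "count_list (v (x + 1)) False = k"
    using that assms(1) by (auto simp: of_bool_def)
  have cut_less: "int (count_list (v y) True) - int (count_list (v (y + 1)) False) =
        of_bool (y < x) - of_bool (y < 0) \<longleftrightarrow>
      count_list (v y) True = count_list (v (y + 1)) False + of_bool (0 \<le> y)" if "y < x" for y
    using that by (auto simp: of_bool_def)
  have cut_greater: "int (count_list (v y) True) - int (count_list (v (y + 1)) False) =
        of_bool (y < x) - of_bool (y < 0) \<longleftrightarrow>
      count_list (v (y + 1)) False = count_list (v y) True + of_bool (y < 0)" if "x < y" for y
    using that by (auto simp: of_bool_def)
  have all_less: "(\<forall>y < x. int (count_list (v y) True) - int (count_list (v (y + 1)) False) =
        of_bool (y < x) - of_bool (y < 0)) \<longleftrightarrow>
      (\<forall>y < x. count_list (v y) True = count_list (v (y + 1)) False + of_bool (0 \<le> y))"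
    using cut_less by blast
  have all_greater: "(\<forall>y > x. int (count_list (v y) True) - int (count_list (v (y + 1)) False) =
        of_bool (y < x) - of_bool (y < 0)) \<longleftrightarrow>
      (\<forall>y > x. count_list (v (y + 1)) False = count_list (v y) True + of_bool (y < 0))"
    using cut_greater by blast
  have le_k: "count_list (v (x + 1)) False \<le> k" if "count_list (v (x + 1)) False = k"
    using that by simp
  show ?thesis
    unfolding right_in_tie_words_iff[OF assms(1,3,4)] left_in_tie_words_iff[OF assms(1,2,5)]
      path_family_def last
      split[of "\<lambda>y. int (count_list (v y) True) - int (count_list (v (y + 1)) False) =
        of_bool (y < x) - of_bool (y < 0)"]
      split[of "\<lambda>y. count_list (v (y + 1)) False \<le> k"] all_less all_greater
    using cut_x le_k by blast
qed


text \<open>This is the combinatorial Ray--Knight theorem: a path corresponds to an arbitrary pair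
  of a left and a right family.\<close>

lemma bij_window_paths:
  assumes "0 < k" "x \<le> int l" "0 \<le> x + 1 + int r"
  shows "bij_betw (\<lambda>w. (map (\<lambda>j. departures (x - int j) 0 w) [0..<l], map (\<lambda>j. departures (x + 1 + int j) 0 w) [0..<r]))
    (window_paths k x i j l r)
    (tie_words True (left_params k x l) (k - of_bool (x < 0)) j \<times> tie_words False (right_params k x r) k i)"
    (is "bij_betw ?f ?W ?T")
proof (rule bij_betw_imageI)
  have W: "w \<in> ?W \<longleftrightarrow> w \<noteq> [] \<and> \<not> last w \<and> endpoint 0 w = x \<and> downs x w = k \<and> (\<forall>y. downs y w \<le> k) \<and>
     card {y. x < y \<and> downs y w = k} = i \<and> card {y. y < x \<and> downs y w = k} = j \<and>
     (\<forall>y. departures y 0 w \<noteq> [] \<longrightarrow> x - int l < y \<and> y \<le> x + int r)" for w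
    by (simp add: window_paths_def tie_paths_def)
  show "inj_on ?f ?W"
  proof (rule inj_onI)
    fix u w assume u: "u \<in> ?W" and w: "w \<in> ?W" and eq: "?f u = ?f w"
    have "departures y 0 u = departures y 0 w" for y
    proof (cases "x - int l < y \<and> y \<le> x + int r")
      case False
      then show ?thesis using u w unfolding W by (metis (no_types, lifting))
    next
      case True
      show ?thesis
      proof (cases "y \<le> x")
        case True
        then have "nat (x - y) < l" "y = x - int (nat (x - y))" using \<open>x - int l < y \<and> _\<close> by auto
        moreover have "departures (x - int j) 0 u = departures (x - int j) 0 w" if "j < l" for j
          using eq that by simp
        ultimately show ?thesis by metis
      next
        case False
        then have "nat (y - x - 1) < r" "y = x + 1 + int (nat (y - x - 1))"
          using \<open>x - int l < y \<and> _\<close> by auto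
        moreover have "departures (x + 1 + int j) 0 u = departures (x + 1 + int j) 0 w" if "j < r" for j
          using eq that by simp
        ultimately show ?thesis by metis
      qed
    qed
    then show "u = w" by (rule departures_inject)
  qed
  show "?f ` ?W = ?T"
  proof (intro equalityI subsetI)
    fix t assume "t \<in> ?f ` ?W"
    then obtain w where w: "w \<in> ?W" and t: "t = ?f w" by blast
    have pf: "path_family x (\<lambda>y. departures y 0 w)" using w path_family_departures unfolding W by blast
    show "t \<in> ?T"
      unfolding t mem_Times_iff fst_conv snd_conv
    proof (rule path_family_iff[OF assms, THEN iffD1])
      show "\<forall>y > x + int r. departures y 0 w = []" "\<forall>y \<le> x - int l. departures y 0 w = []"
        using w unfolding W by fastforce+
    qed (use w pf in \<open>auto simp: W downs_def\<close>)
  next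
    fix t assume "t \<in> ?T"
    then obtain ls rs where t: "t = (ls, rs)"
      and ls: "ls \<in> tie_words True (left_params k x l) (k - of_bool (x < 0)) j"
      and rs: "rs \<in> tie_words False (right_params k x r) k i" by blast
    have len: "length ls = l" "length rs = r"
      using length_tie_words[OF ls] length_tie_words[OF rs] by (simp_all add: left_params_def right_params_def)
    define v where "v y = (if x - int l < y \<and> y \<le> x then ls ! nat (x - y)
      else if x < y \<and> y \<le> x + int r then rs ! nat (y - x - 1) else [])" for y
    have ls_v: "map (\<lambda>j. v (x - int j)) [0..<l] = ls"
      using len by (intro nth_equalityI) (auto simp: v_def)
    have rs_v: "map (\<lambda>j. v (x + 1 + int j)) [0..<r] = rs"
      using len by (intro nth_equalityI) (auto simp: v_def)
    have "path_family x v \<and> count_list (v (x + 1)) False = k \<and> (\<forall>y. count_list (v (y + 1)) False \<le> k) \<and>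
      card {y. x < y \<and> count_list (v (y + 1)) False = k} = i \<and>
      card {y. y < x \<and> count_list (v (y + 1)) False = k} = j"
    proof (rule path_family_iff[OF assms, THEN iffD2])
      show "\<forall>y > x + int r. v y = []" "\<forall>y \<le> x - int l. v y = []"
        by (auto simp: v_def)
    qed (simp add: ls_v rs_v ls rs)
    note v = this
    have ne: "v (x + 1) \<noteq> []" using v assms(1) by auto
    have supp: "\<forall>y. v y \<noteq> [] \<longrightarrow> x - int l < y \<and> y \<le> x + int r" by (simp add: v_def)
    have "v y = []" if "y \<notin> {x - int l<..x + int r}" for y using that supp by auto
    from path_family_surj[OF conjunct1[OF v] ne finite_greaterThanAtMost_int this]
    obtain w where w: "w \<noteq> []" "\<not> last w" "endpoint 0 w = x" "\<And>y. departures y 0 w = v y"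
      by blast
    have "w \<in> ?W"
      unfolding W downs_def w(4) using w(1-3) v supp by blast
    moreover have "?f w = t" by (simp add: t w(4) ls_v rs_v)
    ultimately show "t \<in> ?f ` ?W" by blast
  qed
qed

lemma length_concat_map: "length (concat (map f [0..<n])) = (\<Sum>j<n. length (f j))"
  by (simp add: length_concat comp_def interv_sum_list_conv_sum_set_nat lessThan_atLeast0)

lemma length_window_path:
  assumes "w \<in> window_paths k x i j l r"
  shows "length w = length (concat (map (\<lambda>j. departures (x - int j) 0 w) [0..<l])) +
    length (concat (map (\<lambda>j. departures (x + 1 + int j) 0 w) [0..<r]))"
proof -
  have "length w = (\<Sum>y\<in>{x - int l<..x} \<union> {x<..x + int r}. length (departures y 0 w))"
    by (rule length_eq_sum_departures) (use assms in \<open>force simp: window_paths_def\<close>)+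
  also have "\<dots> = (\<Sum>y\<in>{x - int l<..x}. length (departures y 0 w)) + (\<Sum>y\<in>{x<..x + int r}. length (departures y 0 w))"
    by (rule sum.union_disjoint) auto
  also have "(\<Sum>y\<in>{x - int l<..x}. length (departures y 0 w)) = (\<Sum>j<l. length (departures (x - int j) 0 w))"
    by (rule sum.reindex_bij_witness[of _ "\<lambda>j. x - int j" "\<lambda>y. nat (x - y)"]) auto
  also have "(\<Sum>y\<in>{x<..x + int r}. length (departures y 0 w)) = (\<Sum>j<r. length (departures (x + 1 + int j) 0 w))"
    by (rule sum.reindex_bij_witness[of _ "\<lambda>j. x + 1 + int j" "\<lambda>y. nat (y - x - 1)"]) auto
  finally show ?thesis by (simp add: length_concat_map)
qed

text \<open>Each step is a departure from exactly one site, so the weight factorises along the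
  bijection; this is the independence of the two sides.\<close>

lemma sum_window_paths:
  assumes "0 < k" "x \<le> int l" "0 \<le> x + 1 + int r"
  shows "finite (window_paths k x i j l r)"
    and "(\<Sum>w\<in>window_paths k x i j l r. (1 / 2) ^ length w) =
      tie_prob (left_params k x l) (k - of_bool (x < 0)) j * tie_prob (right_params k x r) k i"
proof -
  note bij = bij_window_paths[OF assms, of i j]
  show "finite (window_paths k x i j l r)"
    unfolding bij_betw_finite[OF bij] using sum_tie_words by blast
  have "(\<Sum>w\<in>window_paths k x i j l r. (1 / 2) ^ length w :: real) =
    (\<Sum>w\<in>window_paths k x i j l r.
      (\<lambda>(ls, rs). (1 / 2) ^ length (concat ls) * (1 / 2) ^ length (concat rs))
        (map (\<lambda>j. departures (x - int j) 0 w) [0..<l], map (\<lambda>j. departures (x + 1 + int j) 0 w) [0..<r]))"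
    by (intro sum.cong refl) (simp add: length_window_path power_add)
  also have "\<dots> = (\<Sum>(ls, rs)\<in>tie_words True (left_params k x l) (k - of_bool (x < 0)) j \<times>
      tie_words False (right_params k x r) k i. (1 / 2) ^ length (concat ls) * (1 / 2) ^ length (concat rs))"
    by (rule sum.reindex_bij_betw[OF bij])
  also have "\<dots> = tie_prob (left_params k x l) (k - of_bool (x < 0)) j * tie_prob (right_params k x r) k i"
    by (simp only: sum.cartesian_product[symmetric] sum_product[symmetric] sum_tie_words[THEN conjunct2])
  finally show "(\<Sum>w\<in>window_paths k x i j l r. (1 / 2) ^ length w) = \<dots>" .
qed

lemma map_upt_eq_replicate:
  assumes "\<And>j. j < n \<Longrightarrow> f j = p" "\<And>j. n \<le> j \<Longrightarrow> f j = q"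
  shows "map f [0..<n + m] = replicate n p @ replicate m q"
  by (rule nth_equalityI) (auto simp: nth_append assms)


text \<open>The window is chosen so that, for every \<open>x\<close>, each side ends with exactly
  \<open>N\<close> generations without immigrants.\<close>

definition big_window_paths :: "nat \<Rightarrow> nat \<Rightarrow> nat \<Rightarrow> nat \<Rightarrow> int \<Rightarrow> word set" where
  "big_window_paths k N i j x = window_paths k x i j (nat x + N) (nat (- x - 1) + N)"

lemma sum_big_window_paths:
  assumes "0 < k"
  shows "finite (big_window_paths k N i j x)"
    and "0 \<le> x \<Longrightarrow> (\<Sum>w\<in>big_window_paths k N i j x. (1 / 2) ^ length w) =
      gw_tie k N k i * bgw_tie k k N (nat x) k j"
    and "x < 0 \<Longrightarrow> (\<Sum>w\<in>big_window_paths k N i j x. (1 / 2) ^ length w) =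
      bgw_tie (k - 1) k N (nat (- x - 1)) k i * gw_tie k N (k - 1) j"
proof -
  note sum = sum_window_paths[OF assms, of x "nat x + N" "nat (- x - 1) + N" i j]
  show "finite (big_window_paths k N i j x)"
    unfolding big_window_paths_def by (rule sum(1)) auto
  have L: "left_params k x (nat x + N) = replicate (nat x) (k, 1) @ replicate N (k, 0)"
    unfolding left_params_def by (rule map_upt_eq_replicate) auto
  have R: "right_params k x (nat (- x - 1) + N) = replicate (nat (- x - 1)) (k - 1, 1) @ replicate N (k, 0)"
    unfolding right_params_def by (rule map_upt_eq_replicate) auto
  have "(\<Sum>w\<in>big_window_paths k N i j x. (1 / 2) ^ length w) =
     tie_prob (replicate (nat x) (k, 1) @ replicate N (k, 0)) (k - of_bool (x < 0)) j *
     tie_prob (replicate (nat (- x - 1)) (k - 1, 1) @ replicate N (k, 0)) k i"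
    unfolding big_window_paths_def L[symmetric] R[symmetric] by (rule sum(2)) auto
  then show "0 \<le> x \<Longrightarrow> (\<Sum>w\<in>big_window_paths k N i j x. (1 / 2) ^ length w) =
      gw_tie k N k i * bgw_tie k k N (nat x) k j"
    and "x < 0 \<Longrightarrow> (\<Sum>w\<in>big_window_paths k N i j x. (1 / 2) ^ length w) =
      bgw_tie (k - 1) k N (nat (- x - 1)) k i * gw_tie k N (k - 1) j"
    by (simp_all add: gw_tie_def bgw_tie_def)
qed

text \<open>The range contains \<open>N + 1\<close> endpoints of either sign, matching the
  \<open>Suc N\<close> lengths of the immigration phase.\<close>

lemma sum_big_window_paths_eq_tie_weight:
  assumes "0 < k"
  shows "(\<Sum>x\<in>{- int N - 1..int N}. \<Sum>w\<in>big_window_paths k N i j x. (1 / 2) ^ length w) =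
    tie_weight k N i j"
proof -
  let ?S = "\<lambda>x. \<Sum>w\<in>big_window_paths k N i j x. (1 / 2) ^ length w :: real"
  have "{- int N - 1..int N} = {0..int N} \<union> {- int N - 1..<0}" by auto
  then have "(\<Sum>x\<in>{- int N - 1..int N}. ?S x) = (\<Sum>x\<in>{0..int N}. ?S x) + (\<Sum>x\<in>{- int N - 1..<0}. ?S x)"
    by (simp only:) (rule sum.union_disjoint, auto)
  also have "(\<Sum>x\<in>{0..int N}. ?S x) = (\<Sum>n<Suc N. gw_tie k N k i * bgw_tie k k N n k j)"
    by (rule sum.reindex_bij_witness[of _ int nat]) (auto simp: sum_big_window_paths(2)[OF assms])
  also have "(\<Sum>x\<in>{- int N - 1..<0}. ?S x) =
      (\<Sum>n<Suc N. bgw_tie (k - 1) k N n k i * gw_tie k N (k - 1) j)"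
    by (rule sum.reindex_bij_witness[of _ "\<lambda>n. - int n - 1" "\<lambda>x. nat (- x - 1)"])
      (auto simp: sum_big_window_paths(3)[OF assms])
  finally show ?thesis
    by (simp only: tie_weight_def bgw_tie_sum_def sum_distrib_left sum_distrib_right)
qed

section \<open>Levels of favorite sites\<close>

lemma sum_UN_le:
  fixes f :: "'b \<Rightarrow> real"
  assumes "finite I" "\<And>i. i \<in> I \<Longrightarrow> finite (A i)" "\<And>x. 0 \<le> f x"
  shows "sum f (\<Union>i\<in>I. A i) \<le> (\<Sum>i\<in>I. sum f (A i))"
  using assms(1,2)
proof (induction I rule: finite_induct)
  case (insert i I)
  have "sum f (\<Union>j\<in>insert i I. A j) = sum f (A i \<union> ((\<Union>j\<in>I. A j) - A i))"
    by (intro arg_cong[of _ _ "sum f"]) auto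
  also have "\<dots> = sum f (A i) + sum f ((\<Union>j\<in>I. A j) - A i)"
    using insert by (intro sum.union_disjoint) auto
  also have "sum f ((\<Union>j\<in>I. A j) - A i) \<le> sum f (\<Union>j\<in>I. A j)"
    using insert assms(3) by (intro sum_mono2) auto
  finally show ?case using insert by force
qed simp

definition level_paths :: "nat \<Rightarrow> nat \<Rightarrow> word set" where
  "level_paths r k = {w. w \<noteq> [] \<and> \<not> last w \<and> downs (endpoint 0 w) w = k \<and> (\<forall>y. downs y w \<le> k) \<and>
     card {y. downs y w = k} = r}"

lemma downs_append: "downs y (u @ v) = downs y u + count_list (departures (y + 1) (endpoint 0 u) v) False"
  by (simp add: downs_def departures_append)

lemma downs_snoc: "downs y (w @ [c]) = downs y w + of_bool (endpoint 0 w = y + 1 \<and> \<not> c)"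
  by (simp add: downs_append)

lemma downs_le_length: "downs y w \<le> length w"
proof (induction w rule: rev_induct)
  case (snoc c w)
  then show ?case by (simp add: downs_snoc)
qed (simp add: downs_def)

lemma endpoint_bound: "\<bar>endpoint p w - p\<bar> \<le> int (length w)"
proof (induction w arbitrary: p)
  case (Cons c w)
  show ?case using Cons[of "p + step_of c"] by (cases c) (auto simp: step_of_def)
qed simp

lemma departures_bound: "departures y p w \<noteq> [] \<Longrightarrow> \<bar>y - p\<bar> < int (length w)"
proof (induction w arbitrary: p)
  case (Cons c w)
  show ?case using Cons.IH[of "p + step_of c"] Cons.prems by (cases c; cases "y = p") (auto simp: step_of_def)
qed simp

text \<open>
  A later path of the same level has one more favorite site, namely its endpoint.
\<close>

lemma level_paths_prefix_free:
  assumes r: "0 < r" and u: "u \<in> level_paths r k" and uv: "u @ v \<in> level_paths r k"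
  shows "v = []"
proof (rule ccontr)
  assume "v \<noteq> []"
  moreover have "\<not> last (u @ v)" using uv by (simp add: level_paths_def)
  ultimately obtain v' where v: "v = v' @ [False]" by (cases v rule: rev_cases) auto
  define x where "x = endpoint 0 (u @ v)"
  have x: "endpoint 0 (u @ v') = x + 1" by (simp add: x_def v endpoint_append step_of_def)
  have "downs x (u @ v) = downs x (u @ v') + 1"
    unfolding v append_assoc[symmetric] downs_snoc x by simp
  moreover have "downs x u \<le> downs x (u @ v')" by (simp add: downs_append)
  ultimately have less: "downs x u < k" and eq: "downs x (u @ v) = k"
    using uv by (simp_all add: level_paths_def x_def)
  have "downs y (u @ v) = k" if "downs y u = k" for y
  proof (rule antisym)
    show "downs y (u @ v) \<le> k" using uv by (simp add: level_paths_def)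
    show "k \<le> downs y (u @ v)" using that by (simp add: downs_append)
  qed
  then have "insert x {y. downs y u = k} \<subseteq> {y. downs y (u @ v) = k}" using eq by auto
  moreover have "finite {y. downs y (u @ v) = k}" "finite {y. downs y u = k}"
    using r u uv by (auto simp: level_paths_def intro: card_ge_0_finite)
  ultimately have "card (insert x {y. downs y u = k}) \<le> card {y. downs y (u @ v) = k}"
    by (intro card_mono)
  then show False
    using \<open>finite {y. downs y u = k}\<close> less u uv by (simp add: level_paths_def)
qed

text \<open>Besides the endpoint there are \<open>n\<close> favorite sites, divided between right
  and left; a path shorter than \<open>N\<close> cannot leave the window.\<close>

lemma level_paths_split:
  assumes w: "w \<in> level_paths (Suc n) k" and "length w < N"
  shows "\<exists>x\<in>{- int N - 1..int N}. \<exists>i\<le>n. w \<in> big_window_paths k N i (n - i) x"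
proof -
  define x where "x = endpoint 0 w"
  define A where "A = {y. x < y \<and> downs y w = k}"
  define B where "B = {y. y < x \<and> downs y w = k}"
  have x: "\<bar>x\<bar> \<le> int (length w)" using endpoint_bound[of 0 w] by (simp add: x_def)
  have dx: "downs x w = k" using w by (simp add: level_paths_def x_def)
  have card: "card {y. downs y w = k} = Suc n" using w by (simp add: level_paths_def)
  then have fin: "finite {y. downs y w = k}" by (intro card_ge_0_finite) simp
  have "{y. downs y w = k} = insert x (A \<union> B)" using dx by (auto simp: A_def B_def)
  moreover have "finite A" "finite B" "A \<inter> B = {}" "x \<notin> A \<union> B"
    using fin by (auto simp: A_def B_def elim: rev_finite_subset)
  ultimately have "Suc n = Suc (card A + card B)"
    using card by (simp add: card_Un_disjoint)
  then have n: "card A \<le> n" "card B = n - card A" by auto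
  have "w \<in> tie_paths k x (card A) (n - card A)"
    using w n(2) dx unfolding tie_paths_def level_paths_def A_def B_def x_def by simp
  moreover have "x - int (nat x + N) < y \<and> y \<le> x + int (nat (- x - 1) + N)" if "departures y 0 w \<noteq> []" for y
    using departures_bound[OF that] assms(2) by auto
  ultimately have "w \<in> big_window_paths k N (card A) (n - card A) x"
    by (simp add: big_window_paths_def window_paths_def)
  then show ?thesis using x assms(2) n(1) by (intro bexI[of _ x] exI[of _ "card A"]) auto
qed

lemma big_window_paths_subset: "big_window_paths k N 0 0 x \<subseteq> {w \<in> level_paths 1 k. endpoint 0 w = x}" if "0 < k"
proof
  fix w assume "w \<in> big_window_paths k N 0 0 x"
  then have w: "w \<in> tie_paths k x 0 0" and win: "\<forall>y. departures y 0 w \<noteq> [] \<longrightarrow> x - int (nat x + N) < y \<and> y \<le> x + int (nat (- x - 1) + N)"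
    by (simp_all add: big_window_paths_def window_paths_def)
  have "{y. downs y w = k} \<subseteq> {x - int (nat x + N) - 1..x + int (nat (- x - 1) + N)}"
  proof
    fix y assume "y \<in> {y. downs y w = k}"
    then have "departures (y + 1) 0 w \<noteq> []" using that by (auto simp: downs_def)
    then show "y \<in> {x - int (nat x + N) - 1..x + int (nat (- x - 1) + N)}" using win by force
  qed
  \<comment> \<open>Finiteness excludes that \<open>card\<close> is 0 for an infinite set, so zero
    ties really means none.\<close>
  then have fin: "finite {y. downs y w = k}" by (rule finite_subset) simp
  have "finite {y. x < y \<and> downs y w = k}" "finite {y. y < x \<and> downs y w = k}"
    using fin by (auto elim: rev_finite_subset)
  then have "{y. x < y \<and> downs y w = k} = {}" "{y. y < x \<and> downs y w = k} = {}"
    using w by (auto simp: tie_paths_def)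
  moreover have "downs x w = k" using w by (simp add: tie_paths_def)
  ultimately have "{y. downs y w = k} = {x}"
    using linorder_less_linear[of _ x] by blast
  then show "w \<in> {w \<in> level_paths 1 k. endpoint 0 w = x}"
    using w by (simp add: tie_paths_def level_paths_def)
qed

section \<open>Cylinder events of the walk and total weights\<close>

context simple_symmetric_random_walk
begin

definition word_event :: "word \<Rightarrow> 'a set" where
  "word_event w = {\<omega> \<in> space M. \<forall>i<length w. S (Suc i) \<omega> - S i \<omega> = step_of (w ! i)}"

lemma measurable_word_event [measurable]: "word_event w \<in> sets M"
  unfolding word_event_def by measurable

lemma prob_word_event: "prob (word_event w) = (1 / 2) ^ length w"
proof (cases "w = []")
  case True
  then show ?thesis by (simp add: word_event_def prob_space)
next
  case False
  let ?X = "\<lambda>n \<omega>. S (Suc n) \<omega> - S n \<omega>"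
  have "word_event w = (\<Inter>i\<in>{..<length w}. ?X i -` {step_of (w ! i)} \<inter> space M)"
    using False by (auto simp: word_event_def)
  also have "prob \<dots> = (\<Prod>i<length w. prob (?X i -` {step_of (w ! i)} \<inter> space M))"
    using False by (intro indep_varsD[OF indep_steps]) auto
  also have "\<dots> = (\<Prod>i<length w. 1 / 2)"
  proof (rule prod.cong)
    fix i
    have "?X i -` {step_of (w ! i)} \<inter> space M = {\<omega> \<in> space M. ?X i \<omega> = step_of (w ! i)}" by auto
    then show "prob (?X i -` {step_of (w ! i)} \<inter> space M) = 1 / 2"
      using prob_up[of i] prob_down[of i] by (simp add: step_of_def)
  qed simp
  finally show ?thesis by simp
qed

lemma AE_step: "AE \<omega> in M. \<forall>n. \<exists>c. S (Suc n) \<omega> - S n \<omega> = step_of c"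
  unfolding AE_all_countable
proof
  fix n
  let ?A = "\<lambda>c. {\<omega> \<in> space M. S (Suc n) \<omega> - S n \<omega> = step_of c}"
  have [measurable]: "?A c \<in> sets M" for c by measurable
  have "prob (?A True \<union> ?A False) = prob (?A True) + prob (?A False)"
    by (rule finite_measure_Union) (auto simp: step_of_def)
  also have "\<dots> = 1" using prob_up[of n] prob_down[of n] by (simp add: step_of_def)
  finally have "AE \<omega> in M. \<omega> \<in> ?A True \<union> ?A False" by (intro AE_prob_1)
  then show "AE \<omega> in M. \<exists>c. S (Suc n) \<omega> - S n \<omega> = step_of c" by eventually_elim blast
qed

text \<open>Kraft's inequality: the cylinder events of prefix-free words are disjoint.\<close>

lemma sum_prefix_free_le_1:
  fixes F :: "word set"
  assumes "finite F" and free: "\<And>u v. u \<in> F \<Longrightarrow> u @ v \<in> F \<Longrightarrow> v = []"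
  shows "(\<Sum>w\<in>F. (1 / 2) ^ length w) \<le> (1 :: real)"
proof -
  have prefix: "take (length u) w = u" if "\<omega> \<in> word_event u" "\<omega> \<in> word_event w" "length u \<le> length w" for u w \<omega>
  proof (rule nth_equalityI)
    fix i assume "i < length (take (length u) w)"
    then have i: "i < length u" "i < length w" by auto
    then have "step_of (u ! i) = step_of (w ! i)" using that by (auto simp: word_event_def)
    then show "take (length u) w ! i = u ! i" using i by (simp add: step_of_def split: if_splits)
  qed (use that in simp)
  have "disjoint_family_on word_event F"
  proof -
    have "u = w" if uw: "u \<in> F" "w \<in> F" "\<omega> \<in> word_event u" "\<omega> \<in> word_event w" "length u \<le> length w" for u w \<omega>
    proof -
      have "w = u @ drop (length u) w" using prefix[OF uw(3-5)] append_take_drop_id[of "length u" w] by simp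
      with uw free[of u "drop (length u) w"] show "u = w" by simp
    qed
    then show ?thesis
      unfolding disjoint_family_on_def by (metis disjoint_iff nle_le)
  qed
  then have "(\<Sum>w\<in>F. prob (word_event w)) = prob (\<Union>w\<in>F. word_event w)"
    using assms(1) by (intro finite_measure_finite_Union[symmetric]) auto
  then show ?thesis by (simp add: prob_word_event)
qed

lemma sum_level_paths_le_1:
  assumes "0 < r" "finite F" "F \<subseteq> level_paths r k"
  shows "(\<Sum>w\<in>F. (1 / 2) ^ length w) \<le> (1 :: real)"
  using assms level_paths_prefix_free[OF assms(1)] by (intro sum_prefix_free_le_1) blast+

text \<open>With no ties the words are those at which a first site reaches level \<open>k\<close>;
  they form a prefix-free set, and different \<open>x\<close> give different endpoints.\<close>

lemma tie_weight_0_le_1: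
  assumes "0 < k" shows "tie_weight k N 0 0 \<le> 1"
proof -
  have "tie_weight k N 0 0 =
      (\<Sum>x\<in>{- int N - 1..int N}. \<Sum>w\<in>big_window_paths k N 0 0 x. (1 / 2) ^ length w)"
    using sum_big_window_paths_eq_tie_weight[OF assms, of N 0 0] by simp
  also have "\<dots> = (\<Sum>w\<in>(\<Union>x\<in>{- int N - 1..int N}. big_window_paths k N 0 0 x). (1 / 2) ^ length w)"
    using big_window_paths_subset[OF assms] sum_big_window_paths(1)[OF assms]
    by (intro sum.UNION_disjoint[symmetric]) (simp, simp, blast)
  also have "\<dots> \<le> 1"
    using big_window_paths_subset[OF assms] sum_big_window_paths(1)[OF assms]
    by (intro sum_level_paths_le_1[of 1 _ k]) (simp, simp, blast)
  finally show ?thesis .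
qed

lemma sum_level_paths_le:
  assumes "0 < k" "F \<subseteq> level_paths (Suc n) k" "\<And>w. w \<in> F \<Longrightarrow> length w < N"
  shows "(\<Sum>w\<in>F. (1 / 2) ^ length w) \<le> (\<Sum>i\<le>n. tie_weight k N i (n - i))"
proof -
  let ?I = "{..n} \<times> {- int N - 1..int N}"
  let ?A = "\<lambda>(i, x). big_window_paths k N i (n - i) x"
  have fin: "finite (?A p)" for p
    using sum_big_window_paths(1)[OF assms(1)] by (simp add: case_prod_unfold)
  have "F \<subseteq> (\<Union>p\<in>?I. ?A p)" using level_paths_split assms(2,3) by fastforce
  then have "(\<Sum>w\<in>F. (1 / 2) ^ length w :: real) \<le> (\<Sum>w\<in>(\<Union>p\<in>?I. ?A p). (1 / 2) ^ length w)"
    using fin by (intro sum_mono2) auto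
  also have "\<dots> \<le> (\<Sum>p\<in>?I. \<Sum>w\<in>?A p. (1 / 2) ^ length w)"
    using fin by (intro sum_UN_le) auto
  also have "\<dots> = (\<Sum>i\<le>n. \<Sum>x\<in>{- int N - 1..int N}. \<Sum>w\<in>big_window_paths k N i (n - i) x. (1 / 2) ^ length w)"
    by (simp only: sum.cartesian_product case_prod_unfold fst_conv snd_conv)
  also have "\<dots> = (\<Sum>i\<le>n. tie_weight k N i (n - i))"
    by (simp only: sum_big_window_paths_eq_tie_weight[OF assms(1)])
  finally show ?thesis .
qed

end

section \<open>From the walk to words and summation over the levels\<close>

lemma downcrossings_Suc:
  "downcrossings s y (Suc n) = downcrossings s y n + of_bool (s (Suc n) = y \<and> s n = y + 1)"
proof -
  let ?A = "\<lambda>n. {k. 0 < k \<and> k \<le> n \<and> s k = y \<and> s (k - 1) = y + 1}"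
  have "?A (Suc n) = (if s (Suc n) = y \<and> s n = y + 1 then insert (Suc n) (?A n) else ?A n)"
    by (auto simp: le_Suc_eq)
  moreover have "finite (?A n)" by (rule finite_subset[of _ "{..n}"]) auto
  ultimately show ?thesis by (simp add: downcrossings_def)
qed

lemma path_of_word:
  assumes "s 0 = 0" "\<And>i. i < length w \<Longrightarrow> s (Suc i) - s i = step_of (w ! i)"
  shows "s (length w) = endpoint 0 w \<and> downcrossings s y (length w) = downs y w"
  using assms(2)
proof (induction w rule: rev_induct)
  case Nil
  then show ?case using assms(1) by (auto simp: downcrossings_def downs_def)
next
  case (snoc c w)
  have "s (length w) = endpoint 0 w \<and> downcrossings s y (length w) = downs y w"
    using snoc.prems by (intro snoc.IH) (metis length_append_singleton less_SucI nth_append_left)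
  moreover have "s (Suc (length w)) - s (length w) = step_of c" using snoc.prems[of "length w"] by simp
  ultimately show ?case
    by (cases c) (auto simp: endpoint_append downs_snoc downcrossings_Suc step_of_def)
qed

definition favorite_words :: "nat \<Rightarrow> word set" where
  "favorite_words r = (\<Union>k. level_paths r k)"

lemma favorite_word:
  assumes s0: "s 0 = 0" and step: "\<forall>n. \<exists>c. s (Suc n) - s n = step_of c"
    and n: "1 \<le> n" "s n \<in> favorite_downcrossing_sites s n" "s n = s (n - 1) - 1"
      "card (favorite_downcrossing_sites s n) = r"
  shows "\<exists>w \<in> favorite_words r. length w = n \<and> (\<forall>i<n. s (Suc i) - s i = step_of (w ! i))"
proof -
  from step obtain c where c: "s (Suc n) - s n = step_of (c n)" for n by metis
  define w where "w = map c [0..<n]"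
  have w: "length w = n" "w \<noteq> []" "\<forall>i<n. s (Suc i) - s i = step_of (w ! i)"
    using n(1) c by (auto simp: w_def)
  have path: "s n = endpoint 0 w" "downcrossings s y n = downs y w" for y
    using path_of_word[of s w y] s0 w by auto
  define k where "k = downs (endpoint 0 w) w"
  have max: "downs y w \<le> k" for y
    using n(2) by (simp add: mem_favorite_downcrossing_sites_iff path k_def)
  have "favorite_downcrossing_sites s n = {y. downs y w = k}"
    using max unfolding set_eq_iff mem_favorite_downcrossing_sites_iff path mem_Collect_eq
    by (metis antisym k_def)
  moreover have "\<not> last w"
  proof -
    have "s (Suc (n - 1)) - s (n - 1) = step_of (w ! (n - 1))"
      using w(3)[rule_format, of "n - 1"] n(1) by simp
    then show ?thesis using n(1,3) w by (auto simp: last_conv_nth step_of_def split: if_splits)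
  qed
  ultimately have "w \<in> level_paths r k"
    using max n(4) w(2) by (simp add: level_paths_def k_def)
  then show ?thesis using w by (auto simp: favorite_words_def)
qed

context simple_symmetric_random_walk
begin

text \<open>Almost surely every counted time \<open>n\<close> is witnessed by the word of the first
  \<open>n\<close> steps; the expectation is then taken term by term.\<close>

lemma favorite_downcrossing_count_le:
  "(\<integral>\<^sup>+\<omega>. favorite_downcrossing_count r (\<lambda>n. S n \<omega>) \<partial>M) \<le>
     (\<Sum>n. \<Sum>w\<in>{w \<in> favorite_words r. length w = n}. ennreal ((1 / 2) ^ n))"
proof -
  let ?F = "\<lambda>n. {w \<in> favorite_words r. length w = n}"
  have fin: "finite (?F n)" for n
    by (rule finite_subset[OF _ finite_lists_length_eq[of UNIV n]]) auto
  have "AE \<omega> in M. favorite_downcrossing_count r (\<lambda>n. S n \<omega>) \<le>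
      (\<Sum>n. \<Sum>w\<in>?F n. indicator (word_event w) \<omega>)"
    using AE_step AE_space
  proof eventually_elim
    case (elim \<omega>)
    let ?s = "\<lambda>n. S n \<omega>"
    let ?E = "{n. n \<ge> 1 \<and> ?s n \<in> favorite_downcrossing_sites ?s n \<and> ?s n = ?s (n - 1) - 1 \<and>
           card (favorite_downcrossing_sites ?s n) = r}"
    have "favorite_downcrossing_count r ?s = (\<Sum>n. indicator ?E n)"
      unfolding favorite_downcrossing_count_def
      by (subst nn_integral_indicator[symmetric], simp) (simp add: nn_integral_count_space_nat)
    also have "\<dots> \<le> (\<Sum>n. \<Sum>w\<in>?F n. indicator (word_event w) \<omega>)"
    proof (rule suminf_le)
      fix n
      show "indicator ?E n \<le> (\<Sum>w\<in>?F n. indicator (word_event w) \<omega> :: ennreal)"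
      proof (cases "n \<in> ?E")
        case True
        then obtain w where w: "w \<in> favorite_words r" "length w = n"
            "\<forall>i<n. ?s (Suc i) - ?s i = step_of (w ! i)"
          using favorite_word[of ?s n r] start[OF elim(2)] elim(1) by blast
        then have "indicator ?E n \<le> (indicator (word_event w) \<omega> :: ennreal)"
          using elim(2) by (simp add: word_event_def indicator_def)
        also have "\<dots> \<le> (\<Sum>w\<in>?F n. indicator (word_event w) \<omega>)"
          using w fin by (intro member_le_sum) auto
        finally show ?thesis .
      qed simp
    qed auto
    finally show ?case .
  qed
  then have "(\<integral>\<^sup>+\<omega>. favorite_downcrossing_count r (\<lambda>n. S n \<omega>) \<partial>M) \<le>
      (\<integral>\<^sup>+\<omega>. (\<Sum>n. \<Sum>w\<in>?F n. indicator (word_event w) \<omega>) \<partial>M)"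
    by (rule nn_integral_mono_AE)
  also have "\<dots> = (\<Sum>n. \<Sum>w\<in>?F n. emeasure M (word_event w))"
    by (subst nn_integral_suminf) (auto simp: nn_integral_sum)
  also have "\<dots> = (\<Sum>n. \<Sum>w\<in>?F n. ennreal ((1 / 2) ^ n))"
    by (intro suminf_cong sum.cong refl) (auto simp: emeasure_eq_measure prob_word_event)
  finally show ?thesis .
qed

text \<open>The factor \<open>Suc n\<close> counts the ways to divide the ties between the two
  sides; the tie-free weight is bounded by 1.\<close>

lemma eventually_sum_level_paths_le:
  "\<exists>K. \<forall>k\<ge>K. \<forall>F N. F \<subseteq> level_paths (Suc n) k \<longrightarrow> (\<forall>w\<in>F. length w < N) \<longrightarrow>
     (\<Sum>w\<in>F. (1 / 2) ^ length w) \<le>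
       real (Suc n) * (1 + 2 * real n) * (18 * real k powr (- 2 / 5)) ^ n"
proof -
  obtain K where K: "\<And>k N i j. K \<le> k \<Longrightarrow> 0 < N \<Longrightarrow>
     tie_weight k N i j \<le> (1 + 2 * real (i + j)) * (18 * real k powr (- 2 / 5)) ^ (i + j) * tie_weight k N 0 0"
    using eventually_tie_weight_le unfolding eventually_sequentially by blast
  show ?thesis
  proof (intro exI[of _ "Suc K"] allI impI)
    fix k F N assume k: "Suc K \<le> k" and F: "F \<subseteq> level_paths (Suc n) k" "\<forall>w\<in>F. length w < N"
    let ?C = "(1 + 2 * real n) * (18 * real k powr (- 2 / 5)) ^ n"
    have C: "0 \<le> ?C" by (intro mult_nonneg_nonneg zero_le_power) auto
    show "(\<Sum>w\<in>F. (1 / 2) ^ length w) \<le>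
       real (Suc n) * (1 + 2 * real n) * (18 * real k powr (- 2 / 5)) ^ n"
    proof (cases "F = {}")
      case False
      then have N: "0 < N" using F(2) by fastforce
      have "(\<Sum>w\<in>F. (1 / 2) ^ length w) \<le> (\<Sum>i\<le>n. tie_weight k N i (n - i))"
        using F k by (intro sum_level_paths_le) auto
      also have "\<dots> \<le> (\<Sum>i\<le>n. ?C)"
      proof (rule sum_mono)
        fix i assume "i \<in> {..n}"
        then have "tie_weight k N i (n - i) \<le> ?C * tie_weight k N 0 0"
          using K[OF _ N, of k i "n - i"] k by simp
        also have "\<dots> \<le> ?C * 1"
          using k by (intro mult_left_mono[OF _ C] tie_weight_0_le_1) simp
        finally show "tie_weight k N i (n - i) \<le> ?C" by simp
      qed
      finally show ?thesis by simp
    qed (use C in \<open>simp add: mult.assoc\<close>)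
  qed
qed

text \<open>Four favorite sites mean three ties, hence \<open>k^(-6/5)\<close> at level
  \<open>k\<close>, which is summable. The finitely many small levels contribute at most 1
  each.\<close>

lemma sum_favorite_words_bounded:
  "\<exists>C. \<forall>N. (\<Sum>w\<in>{w \<in> favorite_words 4. length w < N}. (1 / 2) ^ length w) \<le> (C :: real)"
proof -
  from eventually_sum_level_paths_le[of 3] obtain K where
    K: "\<forall>k\<ge>K. \<forall>F N. F \<subseteq> level_paths (Suc 3) k \<longrightarrow> (\<forall>w\<in>F. length w < N) \<longrightarrow>
     (\<Sum>w\<in>F. (1 / 2) ^ length w) \<le>
       real (Suc 3) * (1 + 2 * real 3) * (18 * real k powr (- 2 / 5)) ^ 3"
    by (rule exE)
  \<comment> \<open>The constant 28 is \<open>4 * 7\<close>, from \<open>Suc n\<close> and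
    \<open>1 + 2 * n\<close> at \<open>n = 3\<close>.\<close>
  define f where "f k = 28 * 18 ^ 3 * real k powr (- 6 / 5)" for k
  have f: "summable f" unfolding f_def
    by (intro summable_mult) (simp add: summable_real_powr_iff)
  have "(\<Sum>w\<in>{w \<in> favorite_words 4. length w < N}. (1 / 2) ^ length w) \<le> real K + suminf f" for N
  proof -
    let ?A = "\<lambda>k. {w \<in> level_paths 4 k. length w < N}"
    have fin: "finite (?A k)" for k
      by (rule finite_subset[OF _ finite_lists_length_le[of UNIV N]]) auto
    have "{w \<in> favorite_words 4. length w < N} \<subseteq> (\<Union>k<N. ?A k)"
    proof
      fix w assume "w \<in> {w \<in> favorite_words 4. length w < N}"
      then obtain k where "w \<in> level_paths 4 k" "length w < N" by (auto simp: favorite_words_def)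
      \<comment> \<open>Downcrossings are steps, so words shorter than \<open>N\<close> only have
        levels below \<open>N\<close>.\<close>
      moreover from this have "k < N" using downs_le_length[of "endpoint 0 w" w] by (simp add: level_paths_def)
      ultimately show "w \<in> (\<Union>k<N. ?A k)" by blast
    qed
    then have "(\<Sum>w\<in>{w \<in> favorite_words 4. length w < N}. (1 / 2) ^ length w :: real) \<le>
        (\<Sum>w\<in>(\<Union>k<N. ?A k). (1 / 2) ^ length w)"
      using fin by (intro sum_mono2) auto
    also have "\<dots> \<le> (\<Sum>k<N. \<Sum>w\<in>?A k. (1 / 2) ^ length w)"
      using fin by (intro sum_UN_le) auto
    also have "\<dots> \<le> (\<Sum>k<N. of_bool (k < K) + f k)"
    proof (rule sum_mono)
      fix k
      show "(\<Sum>w\<in>?A k. (1 / 2) ^ length w) \<le> of_bool (k < K) + f k"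
      proof (cases "k < K")
        case True
        have "(\<Sum>w\<in>?A k. (1 / 2) ^ length w) \<le> (1 :: real)"
          by (rule sum_level_paths_le_1[of 4 _ k]) (simp, rule fin, blast)
        moreover have "0 \<le> f k" by (simp add: f_def)
        ultimately show ?thesis using True by simp
      next
        case False
        have "(\<Sum>w\<in>?A k. (1 / 2) ^ length w) \<le>
            real (Suc 3) * (1 + 2 * real 3) * (18 * real k powr (- 2 / 5)) ^ 3"
          using False by (intro K[rule_format, of k _ N]) auto
        also have "(18 * real k powr (- 2 / 5)) ^ 3 = 18 ^ 3 * real k powr (- 6 / 5)"
          by (cases "k = 0") (simp_all add: power_mult_distrib powr_power)
        also have "real (Suc 3) * (1 + 2 * real 3) * \<dots> = f k"
          by (simp add: f_def)
        finally show ?thesis using False by simp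
      qed
    qed
    also have "\<dots> = (\<Sum>k<N. of_bool (k < K)) + (\<Sum>k<N. f k)"
      by (rule sum.distrib)
    also have "\<dots> \<le> real K + suminf f"
    proof (rule add_mono)
      have "(\<Sum>k<N. of_bool (k < K)) = real (min N K)"
        by (induction N) auto
      then show "(\<Sum>k<N. of_bool (k < K)) \<le> real K" by simp
      show "(\<Sum>k<N. f k) \<le> suminf f"
        using f by (rule sum_le_suminf) (auto simp: f_def)
    qed
    finally show ?thesis .
  qed
  then show ?thesis by blast
qed

end

theorem theorem1p3:
  fixes M :: "'a measure" and S :: "nat \<Rightarrow> 'a \<Rightarrow> int"
  assumes "simple_symmetric_random_walk M S"
  shows "(\<integral>\<^sup>+\<omega>. favorite_downcrossing_count 4 (\<lambda>n. S n \<omega>) \<partial>M) < \<infinity>"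
proof -
  interpret simple_symmetric_random_walk M S by fact
  let ?F = "\<lambda>n. {w \<in> favorite_words 4. length w = n}"
  obtain C where C: "\<And>N. (\<Sum>w\<in>{w \<in> favorite_words 4. length w < N}. (1 / 2) ^ length w) \<le> (C :: real)"
    using sum_favorite_words_bounded by blast
  have fin: "finite (?F n)" for n
    by (rule finite_subset[OF _ finite_lists_length_eq[of UNIV n]]) auto
  have "(\<integral>\<^sup>+\<omega>. favorite_downcrossing_count 4 (\<lambda>n. S n \<omega>) \<partial>M) \<le>
      (\<Sum>n. \<Sum>w\<in>?F n. ennreal ((1 / 2) ^ n))"
    by (rule favorite_downcrossing_count_le)
  also have "\<dots> \<le> ennreal C"
  proof (rule suminf_le_const)
    fix N
    have "(\<Sum>n<N. \<Sum>w\<in>?F n. (1 / 2) ^ n :: real) = (\<Sum>n<N. \<Sum>w\<in>?F n. (1 / 2) ^ length w)"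
      by (intro sum.cong) auto
    also have "\<dots> = (\<Sum>w\<in>(\<Union>n<N. ?F n). (1 / 2) ^ length w)"
      using fin by (intro sum.UNION_disjoint[symmetric]) auto
    also have "(\<Union>n<N. ?F n) = {w \<in> favorite_words 4. length w < N}" by auto
    also have "(\<Sum>w\<in>\<dots>. (1 / 2) ^ length w) \<le> C" by (rule C)
    finally show "(\<Sum>n<N. \<Sum>w\<in>?F n. ennreal ((1 / 2) ^ n)) \<le> ennreal C"
      by (simp add: sum_ennreal sum_nonneg ennreal_leI del: sum_constant)
  qed simp
  also have "\<dots> < \<infinity>" by simp
  finally show ?thesis .
qed

end
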